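(* Let $h:\hat{\mathbb{R}}\to\hat{\mathbb{R}}$ be a quasisymmetric map and let $s:\mathcal{F}\to\mathbb{R}$ be its shear function. Then the triangulation $h(\mathcal{F})$ admits a decoration with bounded (i.e. pinched) lambda lengths if and only if there exists $M>0$ such that for all $p\in\hat{\mathbb{Q}}$, for the fan $\mathcal{F}^p=\{E_j^p\}_{j=-\infty}^{\infty}$ of edges of $\mathcal{F}$ with tip $p$, and for all $n,m\in\mathbb{Z}$ with $n<m$, we have $$\Big|\sum_{j=n}^m s(E_j^p)\Big|\leq M.$$
   Context: $\mathbb{H}$ is the hyperbolic plane (upper half-plane model), with ideal boundary $\hat{\mathbb{R}}=\mathbb{R}\cup\{\infty\}$, which is also identified with the unit circle; $\hat{\mathbb{Q}}=\mathbb{Q}\cup\{\infty\}$. Farey triangulation: $\mathcal{F}$ is the orbit, under the group generated by hyperbolic reflections in the sides of the ideal triangle with vertices $0,1,\infty$, of that triangle; $\mathcal{F}$ also denotes the set of its edges (complete geodesics). Its vertex set is $\hat{\mathbb{Q}}$, and $\frac ab,\frac cd$ (in lowest terms, $\infty=\frac10$) are joined by an edge iff $|ad-bc|=1$. For a homeomorphism $h$ of $\hat{\mathbb{R}}$, $h(\mathcal{F})$ is the ideal triangulation whose edges $h(E)$ are the geodesics with endpoints the $h$-images of the endpoints of $E$, for $E\in\mathcal{F}$. Fan: for $p\in\hat{\mathbb{Q}}$, the fan $\mathcal{F}^p$ with tip $p$ is the set of all edges of $\mathcal{F}$ having $p$ as an endpoint, listed as $\{E_j^p\}_{j\in\mathbb{Z}}$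 so that $E_j^p$ and $E_{j+1}^p$ are sides of a common triangle and $E_j^p$ comes before $E_{j+1}^p$ for the positive orientation of a horocycle based at $p$. Shear: let $\Delta_1,\Delta_2$ be two ideal triangles on opposite sides of a common edge $e$. Orient $e$ as part of the positively oriented boundary of $\Delta_1$. Let $x_i\in e$ be the point where the circle inscribed in $\Delta_i$ (tangent to its three sides) touches $e$. The shear along $e$ is the signed distance from $x_1$ to $x_2$ following the orientation of $e$ (it does not depend on which triangle is called $\Delta_1$). The shear function $s:\mathcal{F}\to\mathbb{R}$ of $h$ assigns to $E\in\mathcal{F}$ the shear along $h(E)$ of the two triangles of $h(\mathcal{F})$ adjacent to $h(E)$. Quasisymmetric: an orientation preserving homeomorphism $h$ of $\hat{\mathbb{R}}$ is quasisymmetric if there is $M>0$ such that for any two adjacent arcs $I,J$ with $|I|=|J|$ we have $1/M\le |h(I)|/|h(J)|\le M$, where $|\cdot|$ is the length of an arc (of the unit circle). Decoration and lambda lengths: a decoration of $h(\mathcal{F})$ is a choice of one horocycle based at each vertex of $h(\mathcal{F})$. Given a decoration, for $E\in\mathcal{F}$ let $\delta(E)$ be the signed hyperbolic distance between the intersection points of $h(E)$ with the two chosen horocycles at its endpoints (positive if the corresponding horodisks are disjoint, negative if they overlap). The lambda length is $\lambda(E)=\sqrt{e^{\delta(E)}}$. The lambda lengths are bounded (pinched) if there is $M'>1$ with $\frac1{M'}\le\lambda(E)\le M'$ for all $E\in\mathcal{F}$. *)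

theory Defs
  imports "HOL-Analysis.Analysis"
begin

section \<open>The ideal boundary\<close>

text \<open>The extended real line; \<open>None\<close> is the point at infinity.\<close>

type_synonym rhat = "real option"

definition rhat_top :: "rhat topology" where
  "rhat_top = Alexandroff_compactification euclideanreal"

definition qhat :: "rhat set" where
  "qhat = insert None (Some ` \<rat>)"

text \<open>\<open>ccw a b c\<close>: the three points are distinct and positively (counterclockwise) ordered.\<close>

fun ccw :: "rhat \<Rightarrow> rhat \<Rightarrow> rhat \<Rightarrow> bool" where
  "ccw (Some x) (Some y) (Some z) \<longleftrightarrow> x < y \<and> y < z \<or> y < z \<and> z < x \<or> z < x \<and> x < y"
| "ccw None (Some y) (Some z) \<longleftrightarrow> y < z"
| "ccw (Some x) None (Some z) \<longleftrightarrow> z < x"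
| "ccw (Some x) (Some y) None \<longleftrightarrow> x < y"
| "ccw _ _ _ \<longleftrightarrow> False"

text \<open>The identification with the unit circle is the boundary value of the Cayley transform
  \<open>z \<mapsto> (z - \<i>) / (z + \<i>)\<close>, which preserves orientation.\<close>

fun to_circle :: "rhat \<Rightarrow> complex" where
  "to_circle (Some x) = (of_real x - \<i>) / (of_real x + \<i>)"
| "to_circle None = 1"

text \<open>Length on the unit circle of the closed arc running counterclockwise from \<open>a\<close> to \<open>b\<close>.\<close>

definition arc_length :: "rhat \<Rightarrow> rhat \<Rightarrow> real" where
  "arc_length a b = Arg2pi (to_circle b / to_circle a)"

definition orientation_preserving_homeo :: "(rhat \<Rightarrow> rhat) \<Rightarrow> bool" where
  "orientation_preserving_homeo h \<longleftrightarrow>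
     homeomorphic_map rhat_top rhat_top h \<and>
     (\<forall>a b c. ccw a b c \<longrightarrow> ccw (h a) (h b) (h c))"

text \<open>Below, \<open>I\<close> is the arc from \<open>a\<close> to \<open>b\<close> and \<open>J\<close> the arc from \<open>b\<close> to \<open>c\<close>; their interiors
  are disjoint exactly when the lengths add up to at most \<open>2 * pi\<close>. As \<open>h\<close> preserves orientation,
  the images are the arcs from \<open>h a\<close> to \<open>h b\<close> and from \<open>h b\<close> to \<open>h c\<close>.\<close>

definition quasisymmetric :: "(rhat \<Rightarrow> rhat) \<Rightarrow> bool" where
  "quasisymmetric h \<longleftrightarrow>
     orientation_preserving_homeo h \<and>
     (\<exists>M>0. \<forall>a b c. a \<noteq> b \<longrightarrow> b \<noteq> c \<longrightarrow>
        arc_length a b = arc_length b c \<longrightarrow>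
        arc_length a b + arc_length b c \<le> 2 * pi \<longrightarrow>
        1 / M \<le> arc_length (h a) (h b) / arc_length (h b) (h c) \<and>
        arc_length (h a) (h b) / arc_length (h b) (h c) \<le> M)"

section \<open>The hyperbolic plane\<close>

definition hplane :: "complex set" where
  "hplane = {z. Im z > 0}"

definition hdist :: "complex \<Rightarrow> complex \<Rightarrow> real" where
  "hdist z w = arcosh (1 + (cmod (z - w))\<^sup>2 / (2 * Im z * Im w))"

definition hcircle :: "complex \<Rightarrow> real \<Rightarrow> complex set" where
  "hcircle w r = {z \<in> hplane. hdist w z = r}"

fun geodesic :: "rhat \<Rightarrow> rhat \<Rightarrow> complex set" where
  "geodesic (Some x) (Some y) =
     {z \<in> hplane. cmod (z - of_real ((x + y) / 2)) = \<bar>x - y\<bar> / 2}"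
| "geodesic (Some x) None = {z \<in> hplane. Re z = x}"
| "geodesic None (Some x) = {z \<in> hplane. Re z = x}"
| "geodesic None None = {}"

text \<open>\<open>precedes a b z w\<close>: on the geodesic oriented from \<open>a\<close> to \<open>b\<close>, the point \<open>z\<close> does not come
  after \<open>w\<close>.\<close>

fun precedes :: "rhat \<Rightarrow> rhat \<Rightarrow> complex \<Rightarrow> complex \<Rightarrow> bool" where
  "precedes (Some x) (Some y) z w \<longleftrightarrow> (if x < y then Re z \<le> Re w else Re w \<le> Re z)"
| "precedes (Some x) None z w \<longleftrightarrow> Im z \<le> Im w"
| "precedes None (Some x) z w \<longleftrightarrow> Im w \<le> Im z"
| "precedes None None z w \<longleftrightarrow> False"

definition signed_dist :: "rhat \<Rightarrow> rhat \<Rightarrow> complex \<Rightarrow> complex \<Rightarrow> real" where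
  "signed_dist a b z w = (if precedes a b z w then hdist z w else - hdist z w)"

text \<open>A hyperbolic circle is tangent to a complete geodesic iff they meet in exactly one point.\<close>

definition tangent :: "complex set \<Rightarrow> complex set \<Rightarrow> bool" where
  "tangent C G \<longleftrightarrow> (\<exists>z. C \<inter> G = {z})"

definition inscribed_circle :: "rhat \<Rightarrow> rhat \<Rightarrow> rhat \<Rightarrow> complex set \<Rightarrow> bool" where
  "inscribed_circle a b c C \<longleftrightarrow>
     (\<exists>w\<in>hplane. \<exists>r>0. C = hcircle w r) \<and>
     tangent C (geodesic a b) \<and> tangent C (geodesic b c) \<and> tangent C (geodesic c a)"

text \<open>The point where the circle inscribed in the ideal triangle with vertices \<open>a\<close>, \<open>b\<close>, \<open>c\<close>
  touches the side from \<open>a\<close> to \<open>b\<close>.\<close>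

definition touching_point :: "rhat \<Rightarrow> rhat \<Rightarrow> rhat \<Rightarrow> complex" where
  "touching_point a b c = (THE z. \<exists>C. inscribed_circle a b c C \<and> C \<inter> geodesic a b = {z})"

text \<open>The shear along the common side \<open>{a, b}\<close> of the ideal triangles \<open>a, b, c\<close> and \<open>a, b, d\<close>.
  It is meant for \<open>ccw a b c\<close>, when the side, as part of the positively oriented boundary of the
  first triangle, runs from \<open>a\<close> to \<open>b\<close>.\<close>

definition shear :: "rhat \<Rightarrow> rhat \<Rightarrow> rhat \<Rightarrow> rhat \<Rightarrow> real" where
  "shear a b c d = signed_dist a b (touching_point a b c) (touching_point a b d)"

section \<open>The Farey triangulation\<close>

text \<open>The action on the ideal boundary of the hyperbolic reflection in the geodesic with the
  given endpoints.\<close>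

fun reflect :: "rhat \<Rightarrow> rhat \<Rightarrow> rhat \<Rightarrow> rhat" where
  "reflect (Some x) (Some y) (Some t) =
     (if t = (x + y) / 2 then None
      else Some ((x + y) / 2 + ((x - y) / 2)\<^sup>2 / (t - (x + y) / 2)))"
| "reflect (Some x) (Some y) None = Some ((x + y) / 2)"
| "reflect (Some x) None t = map_option (\<lambda>u. 2 * x - u) t"
| "reflect None (Some x) t = map_option (\<lambda>u. 2 * x - u) t"
| "reflect None None t = t"

text \<open>Ideal triangles are represented by their sets of vertices, and edges by their sets of
  endpoints. The generating reflections are involutions, so closing under them yields the orbit
  of the group they generate.\<close>

inductive_set farey_triangles :: "rhat set set" where
  base: "{Some 0, Some 1, None} \<in> farey_triangles"
| step: "T \<in> farey_triangles \<Longrightarrow> a \<in> {Some 0, Some 1, None} \<Longrightarrow> b \<in> {Some 0, Some 1, None} \<Longrightarrow>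
         a \<noteq> b \<Longrightarrow> reflect a b ` T \<in> farey_triangles"

definition farey_edges :: "rhat set set" where
  "farey_edges = {E. card E = 2 \<and> (\<exists>T\<in>farey_triangles. E \<subseteq> T)}"

definition fan :: "rhat \<Rightarrow> rhat set set" where
  "fan p = {E \<in> farey_edges. p \<in> E}"

text \<open>A listing of the fan with tip \<open>p\<close>, unique up to a shift of the index. A horocycle based
  at \<open>p\<close> with its positive orientation crosses the geodesic from \<open>p\<close> to \<open>x\<close> before the one from
  \<open>p\<close> to \<open>y\<close> iff \<open>ccw p x y\<close>: for \<open>p = None\<close> it is a horizontal line run from left to right.\<close>

definition fan_listing :: "rhat \<Rightarrow> (int \<Rightarrow> rhat set) \<Rightarrow> bool" where
  "fan_listing p E \<longleftrightarrow>
     bij_betw E UNIV (fan p) \<and>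
     (\<forall>j. (\<exists>T\<in>farey_triangles. E j \<subseteq> T \<and> E (j + 1) \<subseteq> T) \<and>
          (\<exists>x y. E j = {p, x} \<and> E (j + 1) = {p, y} \<and> ccw p x y))"

text \<open>The shear function of \<open>h\<close>. The two Farey triangles adjacent to \<open>{a, b}\<close> have third vertices
  \<open>c\<close> and \<open>d\<close>; exchanging them (and \<open>a\<close> with \<open>b\<close>) leaves the shear unchanged.\<close>

definition shear_function :: "(rhat \<Rightarrow> rhat) \<Rightarrow> rhat set \<Rightarrow> real" where
  "shear_function h E = (THE s. \<exists>a b c d. E = {a, b} \<and> c \<noteq> d \<and>
     {a, b, c} \<in> farey_triangles \<and> {a, b, d} \<in> farey_triangles \<and>
     ccw (h a) (h b) (h c) \<and> s = shear (h a) (h b) (h c) (h d))"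

section \<open>Decorations and lambda lengths\<close>

text \<open>Horocycles based at a given point are parametrized by a positive size: the height of the
  horizontal line at infinity, the Euclidean radius of the tangent circle elsewhere.\<close>

fun horocycle :: "rhat \<Rightarrow> real \<Rightarrow> complex set" where
  "horocycle (Some x) k = {z \<in> hplane. cmod (z - Complex x k) = k}"
| "horocycle None k = {z \<in> hplane. Im z = k}"

fun horodisk :: "rhat \<Rightarrow> real \<Rightarrow> complex set" where
  "horodisk (Some x) k = {z \<in> hplane. cmod (z - Complex x k) < k}"
| "horodisk None k = {z \<in> hplane. Im z > k}"

text \<open>A decoration of the image of the Farey triangulation chooses a horocycle, given by its size,
  at each vertex \<open>h p\<close>.\<close>

definition decoration :: "(rhat \<Rightarrow> rhat) \<Rightarrow> (rhat \<Rightarrow> real) \<Rightarrow> bool" where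
  "decoration h k \<longleftrightarrow> (\<forall>p\<in>qhat. k (h p) > 0)"

definition horocycle_point :: "(rhat \<Rightarrow> real) \<Rightarrow> rhat \<Rightarrow> rhat \<Rightarrow> complex" where
  "horocycle_point k a b = (THE z. z \<in> geodesic a b \<inter> horocycle a (k a))"

definition horocycle_dist :: "(rhat \<Rightarrow> real) \<Rightarrow> rhat \<Rightarrow> rhat \<Rightarrow> real" where
  "horocycle_dist k a b =
     (let \<delta> = hdist (horocycle_point k a b) (horocycle_point k b a)
      in if horodisk a (k a) \<inter> horodisk b (k b) = {} then \<delta> else - \<delta>)"

definition lambda_length :: "(rhat \<Rightarrow> real) \<Rightarrow> rhat \<Rightarrow> rhat \<Rightarrow> real" where
  "lambda_length k a b = sqrt (exp (horocycle_dist k a b))"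

definition pinched_lambda_lengths :: "(rhat \<Rightarrow> rhat) \<Rightarrow> (rhat \<Rightarrow> real) \<Rightarrow> bool" where
  "pinched_lambda_lengths h k \<longleftrightarrow>
     (\<exists>M>1. \<forall>a b. {a, b} \<in> farey_edges \<longrightarrow>
        1 / M \<le> lambda_length k (h a) (h b) \<and> lambda_length k (h a) (h b) \<le> M)"

end

theory Submission
  imports Defs
begin

text \<open>
  For boundary points \<open>a\<close>, \<open>b\<close> let \<open>W a b\<close> be the difference of their coordinates, and \<open>1\<close> up to sign
  when one of them is \<open>\<infinity>\<close> (\<open>bracket\<close> below). Everything in the statement is a multiplicative
  expression in the \<open>\<bar>W a b\<bar>\<close>. If \<open>u a\<close> is \<open>1 / (2 k)\<close> for a horocycle of radius \<open>k\<close> at a finite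
  point \<open>a\<close>, and the height of the horocycle for \<open>a = \<infinity>\<close>, then the lambda length of the edge
  \<open>a b\<close> is \<open>\<bar>W a b\<bar> sqrt (u a * u b)\<close> (\<open>ln_lambda_length\<close>); and the shear along \<open>a b\<close>
  of the triangles \<open>a b c\<close> and \<open>a b d\<close> is the logarithm of the cross ratio
  \<open>\<bar>W a d\<bar> \<bar>W b c\<bar> / (\<bar>W a c\<bar> \<bar>W b d\<bar>)\<close> (\<open>shear_eq\<close>).

  Attach to the corner at \<open>p\<close> of a Farey triangle \<open>p q r\<close> the number
  \<open>c = \<bar>W (h q) (h r)\<bar> / (\<bar>W (h p) (h q)\<bar> \<bar>W (h p) (h r)\<bar>)\<close>, which is, up to a factor depending
  on \<open>p\<close> alone, the length that the triangle cuts out of a horocycle at \<open>h p\<close>. The shear along an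
  edge of the fan at \<open>p\<close> is the increment of \<open>ln c\<close> between the two corners that meet along the
  edge (\<open>shear_function_fan\<close>), so the sums over a fan telescope, and they are bounded
  exactly when, uniformly in \<open>p\<close>, \<open>ln c\<close> varies by a bounded amount among the corners at \<open>p\<close>
  (\<open>bounded_fan_sums_iff\<close>).

  This last condition is equivalent to the existence of a pinched decoration
  (\<open>pinched_decoration_iff\<close>). Given a decoration, \<open>c\<close> is \<open>u (h p)\<close> times a quotient of three
  lambda lengths, so pinched lambda lengths keep \<open>ln c - ln (u (h p))\<close> bounded. Conversely,
  choose \<open>u (h p)\<close> within a bounded factor of all \<open>c\<close> at \<open>p\<close>. The corners of one triangle
  at \<open>p\<close> and at \<open>q\<close> have the product \<open>1 / \<bar>W (h p) (h q)\<bar>\<^sup>2\<close>, so the squared lambda length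
  \<open>\<bar>W (h p) (h q)\<bar>\<^sup>2 * u (h p) * u (h q)\<close> of that edge is pinched as well.

  The combinatorics needed is that the triangles with a given vertex form a sequence in which
  neighbours share an edge. At \<open>\<infinity>\<close> these are the triangles \<open>\<infinity>, j, j + 1\<close> with \<open>j\<close> an integer;
  symmetries of the Farey triangulation carry this to every other vertex (\<open>farey_vertex_fan\<close>).
\<close>

section \<open>Points of a geodesic\<close>

text \<open>The determinant of the homogeneous coordinate vectors of two boundary points, \<open>(x, 1)\<close> for a
  real \<open>x\<close> and \<open>(1, 0)\<close> for \<open>\<infinity>\<close>. Its modulus measures distances, and its sign pattern records the cyclic order.\<close>

fun bracket :: "rhat \<Rightarrow> rhat \<Rightarrow> real" where
  "bracket (Some x) (Some y) = x - y"
| "bracket None (Some y) = 1"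
| "bracket (Some x) None = - 1"
| "bracket None None = 0"

text \<open>The squared Euclidean distance, with the value \<open>1\<close> at \<open>\<infinity>\<close> that makes the formulas below uniform:
  \<open>dist_sq z a / Im z\<close> is constant on each horocycle based at \<open>a\<close>.\<close>

fun dist_sq :: "complex \<Rightarrow> rhat \<Rightarrow> real" where
  "dist_sq z (Some x) = (Re z - x)\<^sup>2 + (Im z)\<^sup>2"
| "dist_sq z None = 1"

text \<open>The point \<open>z\<close> of the geodesic from \<open>a\<close> to \<open>b\<close> with \<open>dist_sq z a = t\<^sup>2 * dist_sq z b\<close>. For \<open>a = 0\<close>
  and \<open>b = \<infinity>\<close> it is \<open>t * \<i>\<close>, so \<open>ln t\<close> is an arc length parameter.\<close>

fun geo_point :: "rhat \<Rightarrow> rhat \<Rightarrow> real \<Rightarrow> complex" where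
  "geo_point (Some x) (Some y) t = Complex ((x + t\<^sup>2 * y) / (1 + t\<^sup>2)) (t * \<bar>x - y\<bar> / (1 + t\<^sup>2))"
| "geo_point (Some x) None t = Complex x t"
| "geo_point None (Some y) t = Complex y (1 / t)"
| "geo_point None None t = 0"

lemma bracket_eq_0_iff [simp]: "bracket a b = 0 \<longleftrightarrow> a = b"
  by (cases a; cases b) auto

lemma bracket_swap: "bracket b a = - bracket a b"
  by (cases a; cases b) auto

lemma abs_bracket_commute: "\<bar>bracket b a\<bar> = \<bar>bracket a b\<bar>"
  by (cases a; cases b) auto

lemma ccw_iff_bracket: "ccw a b c \<longleftrightarrow> bracket a b * bracket b c * bracket c a > 0"
  by (cases a; cases b; cases c)
     (auto simp: zero_less_mult_iff mult_less_0_iff)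

lemma dist_sq_pos: "z \<in> hplane \<Longrightarrow> dist_sq z a > 0"
  by (cases a) (auto simp: hplane_def add_nonneg_pos)

lemma geodesic_commute: "geodesic a b = geodesic b a"
  by (cases a; cases b) (auto simp: add.commute abs_minus_commute)

lemma geo_point_flip:
  assumes "t > 0"
  shows "geo_point b a (1 / t) = geo_point a b t"
proof (cases a; cases b)
  fix x y assume *: "a = Some x" "b = Some y"
  have pos: "1 + t\<^sup>2 > 0" by (simp add: add_pos_nonneg)
  have 1: "1 + (1 / t)\<^sup>2 = (1 + t\<^sup>2) / t\<^sup>2" "y + (1 / t)\<^sup>2 * x = (x + t\<^sup>2 * y) / t\<^sup>2"
    using assms by (simp_all add: field_simps)
  show ?thesis
    using assms pos unfolding * by (simp only: geo_point.simps 1) (simp add: power2_eq_square abs_minus_commute)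
qed (use assms in auto)

lemma geo_point_in_hplane: "a \<noteq> b \<Longrightarrow> t > 0 \<Longrightarrow> geo_point a b t \<in> hplane"
  by (cases a; cases b) (auto simp: hplane_def add_pos_nonneg intro!: divide_pos_pos mult_pos_pos)

lemma dist_sq_geo_point_left:
  assumes "a \<noteq> b" "t > 0"
  shows "dist_sq (geo_point a b t) a = t * \<bar>bracket a b\<bar> * Im (geo_point a b t)"
proof (cases a; cases b)
  fix x y assume *: "a = Some x" "b = Some y"
  have pos: "1 + t\<^sup>2 > 0" by (simp add: add_pos_nonneg)
  have re: "(x + t\<^sup>2 * y) / (1 + t\<^sup>2) - x = t\<^sup>2 * (y - x) / (1 + t\<^sup>2)"
    using pos by (simp add: field_simps)
  have num: "(t\<^sup>2 * (y - x))\<^sup>2 + (t * \<bar>x - y\<bar>)\<^sup>2 = (t\<^sup>2 * (1 + t\<^sup>2)) * (x - y)\<^sup>2"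
    by (simp add: power_mult_distrib) algebra
  have "(t\<^sup>2 * (y - x) / (1 + t\<^sup>2))\<^sup>2 + (t * \<bar>x - y\<bar> / (1 + t\<^sup>2))\<^sup>2
      = (t\<^sup>2 * (1 + t\<^sup>2)) * (x - y)\<^sup>2 / (1 + t\<^sup>2)\<^sup>2"
    unfolding power_divide add_divide_distrib[symmetric] num ..
  also have "\<dots> = t\<^sup>2 * (x - y)\<^sup>2 / (1 + t\<^sup>2)"
    using pos by (simp add: power2_eq_square)
  also have "\<dots> = t * \<bar>x - y\<bar> * (t * \<bar>x - y\<bar> / (1 + t\<^sup>2))"
    by (simp add: power2_eq_square abs_mult_self_eq)
  finally show ?thesis unfolding * by (simp add: re)
qed (use assms in \<open>auto simp: power2_eq_square\<close>)

lemma dist_sq_geo_point_right: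
  assumes "a \<noteq> b" "t > 0"
  shows "dist_sq (geo_point a b t) b = \<bar>bracket a b\<bar> * Im (geo_point a b t) / t"
  using dist_sq_geo_point_left[of b a "1 / t"] assms geo_point_flip[OF assms(2), of b a]
  by (simp add: abs_bracket_commute)

lemma geodesic_Some_Some:
  "geodesic (Some x) (Some y) = {z \<in> hplane. (Re z - x) * (y - Re z) = (Im z)\<^sup>2}"
proof -
  have "cmod (z - of_real ((x + y) / 2)) = \<bar>x - y\<bar> / 2 \<longleftrightarrow> (Re z - x) * (y - Re z) = (Im z)\<^sup>2" for z
  proof -
    have "cmod (z - of_real ((x + y) / 2)) = \<bar>x - y\<bar> / 2 \<longleftrightarrow>
        (cmod (z - of_real ((x + y) / 2)))\<^sup>2 = (\<bar>x - y\<bar> / 2)\<^sup>2"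
      by (simp add: power2_eq_iff_nonneg)
    also have "\<dots> \<longleftrightarrow> (Re z - (x + y) / 2)\<^sup>2 + (Im z)\<^sup>2 = ((x - y) / 2)\<^sup>2"
      by (simp add: cmod_power2 power_divide)
    also have "\<dots> \<longleftrightarrow> (Re z - x) * (y - Re z) = (Im z)\<^sup>2"
      by (simp add: field_simps power2_eq_square) argo
    finally show ?thesis .
  qed
  then show ?thesis by simp
qed

lemma geo_point_in_geodesic:
  assumes "a \<noteq> b" "t > 0"
  shows "geo_point a b t \<in> geodesic a b"
proof (cases a; cases b)
  fix x y assume *: "a = Some x" "b = Some y"
  have pos: "1 + t\<^sup>2 > 0" by (simp add: add_pos_nonneg)
  have "(x + t\<^sup>2 * y) / (1 + t\<^sup>2) - x = t\<^sup>2 * (y - x) / (1 + t\<^sup>2)"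
       "y - (x + t\<^sup>2 * y) / (1 + t\<^sup>2) = (y - x) / (1 + t\<^sup>2)"
    using pos by (simp_all add: field_simps)
  then show ?thesis
    using geo_point_in_hplane[OF assms] unfolding * geodesic_Some_Some
    by (simp add: power_divide power_mult_distrib power2_eq_square) (simp add: algebra_simps)
qed (use assms geo_point_in_hplane[OF assms] in auto)

lemma geodesic_Some_less:
  assumes "x < y" "z \<in> geodesic (Some x) (Some y)"
  shows "\<exists>t>0. z = geo_point (Some x) (Some y) t"
proof -
  define X Y where "X = Re z" and "Y = Im z"
  have Y: "Y > 0" and eq: "(X - x) * (y - X) = Y\<^sup>2"
    using assms unfolding geodesic_Some_Some X_def Y_def hplane_def by auto
  have "(X - x) * (y - X) > 0" using Y eq by simp
  then have X: "x < X" "X < y" using assms(1) by (auto simp: zero_less_mult_iff)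
  define t where "t = (X - x) / Y"
  have t: "t > 0" using X Y by (simp add: t_def)
  have "1 + t\<^sup>2 = (Y\<^sup>2 + (X - x)\<^sup>2) / Y\<^sup>2"
    using Y by (simp add: t_def power_divide add_divide_distrib)
  also have "Y\<^sup>2 + (X - x)\<^sup>2 = (X - x) * (y - x)"
    unfolding eq[symmetric] by (simp add: algebra_simps power2_eq_square)
  finally have 1: "1 + t\<^sup>2 = (X - x) * (y - x) / Y\<^sup>2" .
  have pos: "1 + t\<^sup>2 > 0" by (simp add: add_pos_nonneg)
  have "(x + t\<^sup>2 * y) / (1 + t\<^sup>2) = x + t\<^sup>2 * (y - x) / (1 + t\<^sup>2)"
    using pos by (simp add: field_simps)
  also have "t\<^sup>2 * (y - x) / (1 + t\<^sup>2) = X - x"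
    unfolding 1 using X Y by (simp add: t_def power2_eq_square)
  finally have re: "(x + t\<^sup>2 * y) / (1 + t\<^sup>2) = X" by simp
  have "t * \<bar>x - y\<bar> / (1 + t\<^sup>2) = Y"
    unfolding 1 using X Y by (simp add: t_def power2_eq_square)
  with re t show ?thesis
    by (intro exI[of _ t]) (auto simp: X_def Y_def complex_eq_iff)
qed

lemma geodesic_eq_image:
  assumes "a \<noteq> b"
  shows "geodesic a b = geo_point a b ` {0<..}"
proof
  show "geo_point a b ` {0<..} \<subseteq> geodesic a b"
    using geo_point_in_geodesic[OF assms] by auto
  have "\<exists>t>0. z = geo_point a b t" if z: "z \<in> geodesic a b" for z
  proof (cases a; cases b)
    fix x y assume *: "a = Some x" "b = Some y"
    show ?thesis
    proof (cases "x < y")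
      case True
      then show ?thesis using geodesic_Some_less[of x y z] z by (simp only: *)
    next
      case False
      then have "y < x" using assms * by simp
      moreover have "z \<in> geodesic b a" using z by (simp only: geodesic_commute[of b a])
      ultimately obtain t where "t > 0" "z = geo_point b a t"
        using geodesic_Some_less[of y x z] by (auto simp only: *)
      then show ?thesis using geo_point_flip[of t a b] by (intro exI[of _ "1 / t"]) simp
    qed
  next
    fix x assume *: "a = Some x" "b = None"
    then show ?thesis using z by (intro exI[of _ "Im z"]) (auto simp: hplane_def complex_eq_iff)
  next
    fix y assume *: "a = None" "b = Some y"
    then show ?thesis using z by (intro exI[of _ "1 / Im z"]) (auto simp: hplane_def complex_eq_iff)
  qed (use assms in auto)
  then show "geodesic a b \<subseteq> geo_point a b ` {0<..}" by auto
qed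

lemma geo_point_inject:
  assumes "a \<noteq> b" "s > 0" "t > 0"
  shows "geo_point a b s = geo_point a b t \<longleftrightarrow> s = t"
proof
  assume eq: "geo_point a b s = geo_point a b t"
  have "Im (geo_point a b t) > 0"
    using geo_point_in_hplane assms by (auto simp: hplane_def)
  then show "s = t"
    using dist_sq_geo_point_left[of a b s] dist_sq_geo_point_left[of a b t] assms
    unfolding eq by simp
qed auto

lemma cosh_hdist:
  assumes "z \<in> hplane" "w \<in> hplane"
  shows "cosh (hdist z w) = ((Re z - Re w)\<^sup>2 + (Im z)\<^sup>2 + (Im w)\<^sup>2) / (2 * Im z * Im w)"
proof -
  have pos: "Im z > 0" "Im w > 0" using assms by (auto simp: hplane_def)
  have "cosh (hdist z w) = 1 + (cmod (z - w))\<^sup>2 / (2 * Im z * Im w)"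
    unfolding hdist_def using pos by (intro cosh_arcosh_real) auto
  also have "\<dots> = ((Re z - Re w)\<^sup>2 + (Im z)\<^sup>2 + (Im w)\<^sup>2) / (2 * Im z * Im w)"
    unfolding cmod_power2 using pos by (simp add: field_simps power2_eq_square)
  finally show ?thesis .
qed

lemma hdist_nonneg: "z \<in> hplane \<Longrightarrow> w \<in> hplane \<Longrightarrow> hdist z w \<ge> 0"
  unfolding hdist_def hplane_def by (intro arcosh_nonneg_real) auto

text \<open>In the hyperboloid model \<open>geo_point a b t\<close> is a combination of the two null vectors \<open>a\<close> and \<open>b\<close>
  with weights proportional to \<open>1 / t\<close> and \<open>t\<close>, and \<open>dist_sq w a / Im w\<close> is, up to a factor, the
  pairing of \<open>w\<close> with the null vector \<open>a\<close>. This linearity in the weights is what turns the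
  intersection of a circle with a geodesic into a quadratic equation for \<open>t\<close>.\<close>

lemma cosh_hdist_geo_point:
  assumes "a \<noteq> b" "t > 0" "w \<in> hplane"
  shows "cosh (hdist w (geo_point a b t)) =
    (dist_sq w a / t + t * dist_sq w b) / (2 * \<bar>bracket a b\<bar> * Im w)"
proof -
  have w: "Im w > 0" using assms by (auto simp: hplane_def)
  note * = cosh_hdist[OF assms(3) geo_point_in_hplane[OF assms(1,2)]]
  show ?thesis
  proof (cases a; cases b)
    fix x y assume ab: "a = Some x" "b = Some y"
    have pos: "1 + t\<^sup>2 > 0" by (simp add: add_pos_nonneg)
    define N D where "N = 1 + t\<^sup>2" and "D = \<bar>x - y\<bar>"
    have ND: "N > 0" "D > 0" "D\<^sup>2 = (x - y)\<^sup>2" using pos assms ab by (auto simp: N_def D_def)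
    have "((Re w - (x + t\<^sup>2 * y) / N)\<^sup>2 + (Im w)\<^sup>2 + (t * D / N)\<^sup>2)
       = ((N * Re w - (x + t\<^sup>2 * y))\<^sup>2 + (N * Im w)\<^sup>2 + (t * D)\<^sup>2) / N\<^sup>2"
      using ND by (simp add: field_simps power2_eq_square)
    also have "(N * Re w - (x + t\<^sup>2 * y))\<^sup>2 + (N * Im w)\<^sup>2 + (t * D)\<^sup>2
      = N * (dist_sq w a + t\<^sup>2 * dist_sq w b)"
      unfolding ab power_mult_distrib ND(3) by (simp add: N_def) algebra
    finally have "cosh (hdist w (geo_point a b t)) =
        (N * (dist_sq w a + t\<^sup>2 * dist_sq w b)) / N\<^sup>2 / (2 * Im w * (t * D / N))"
      using * unfolding ab by (simp add: N_def D_def)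
    also have "\<dots> = (dist_sq w a / t + t * dist_sq w b) / (2 * D * Im w)"
      using ND w assms(2) by (simp add: field_simps power2_eq_square)
    finally show ?thesis by (simp add: ab D_def)
  next
    fix y assume ab: "a = None" "b = Some y"
    have "(E + (1 / t)\<^sup>2) / (2 * Im w * (1 / t)) = (1 / t + t * E) / (2 * Im w)" for E
      using w assms(2) by (simp add: field_simps power2_eq_square)
    then show ?thesis using * unfolding ab by simp
  next
    fix x assume ab: "a = Some x" "b = None"
    have "(E + t\<^sup>2) / (2 * Im w * t) = (E / t + t) / (2 * Im w)" for E
      using w assms(2) by (simp add: field_simps power2_eq_square)
    then show ?thesis using * unfolding ab by simp
  qed (use assms in auto)
qed

lemma hdist_geo_point:
  assumes "a \<noteq> b" "s > 0" "t > 0"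
  shows "hdist (geo_point a b s) (geo_point a b t) = \<bar>ln (t / s)\<bar>"
proof -
  let ?z = "geo_point a b s" and ?w = "geo_point a b t"
  have hp: "?z \<in> hplane" "?w \<in> hplane" using assms geo_point_in_hplane by auto
  then have Im: "Im ?z > 0" by (simp add: hplane_def)
  have W: "\<bar>bracket a b\<bar> > 0" using assms by simp
  have eq: "(s * X / t + t * (X / s)) / (2 * X) = (t / s + s / t) / 2" if "X > 0" for X
    using that assms by (simp add: field_simps)
  have "cosh (hdist ?z ?w) = (t / s + s / t) / 2"
    unfolding cosh_hdist_geo_point[OF assms(1,3) hp(1)]
      dist_sq_geo_point_left[OF assms(1,2)] dist_sq_geo_point_right[OF assms(1,2)]
    using eq[of "\<bar>bracket a b\<bar> * Im ?z"] Im W by (simp add: mult.assoc)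
  also have "\<dots> = cosh (ln (t / s))"
    using assms by (simp add: cosh_ln_real)
  finally have "cosh (hdist ?z ?w) = cosh \<bar>ln (t / s)\<bar>" by simp
  then show "hdist ?z ?w = \<bar>ln (t / s)\<bar>"
    using hdist_nonneg[OF hp] by (metis abs_ge_zero arcosh_cosh_real)
qed

lemma signed_dist_geo_point:
  assumes "a \<noteq> b" "s > 0" "t > 0"
  shows "signed_dist a b (geo_point a b s) (geo_point a b t) = ln (t / s)"
proof -
  let ?z = "geo_point a b s" and ?w = "geo_point a b t"
  have "precedes a b ?z ?w \<longleftrightarrow> s \<le> t"
  proof (cases a; cases b)
    fix x y assume *: "a = Some x" "b = Some y"
    have re: "(x + r\<^sup>2 * y) / (1 + r\<^sup>2) = y - (y - x) / (1 + r\<^sup>2)" for r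
    proof -
      have "1 + r\<^sup>2 > 0" by (simp add: add_pos_nonneg)
      then show ?thesis by (simp add: field_simps)
    qed
    have pos: "1 + s\<^sup>2 > 0" "1 + t\<^sup>2 > 0" by (simp_all add: add_pos_nonneg)
    have mono: "c / (1 + t\<^sup>2) \<le> c / (1 + s\<^sup>2) \<longleftrightarrow> s \<le> t" if "c > 0" for c
    proof -
      have "c / (1 + t\<^sup>2) \<le> c / (1 + s\<^sup>2) \<longleftrightarrow> 1 + s\<^sup>2 \<le> 1 + t\<^sup>2"
        using that pos by (simp add: divide_le_cancel frac_le_eq divide_simps)
      also have "\<dots> \<longleftrightarrow> s \<le> t"
        using assms by (simp add: power_mono_iff)
      finally show ?thesis .
    qed
    have mono': "c / (1 + s\<^sup>2) \<le> c / (1 + t\<^sup>2) \<longleftrightarrow> s \<le> t" if "c < 0" for c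
      using mono[of "- c"] that by simp
    show ?thesis
    proof (cases "x < y")
      case True
      then show ?thesis using mono[of "y - x"] by (simp add: * re)
    next
      case False
      then have "x > y" using * assms(1) by auto
      then show ?thesis using mono'[of "y - x"] by (simp add: * re)
    qed
  next
    fix y assume *: "a = None" "b = Some y"
    then show ?thesis using assms by (simp add: divide_simps)
  qed (use assms in auto)
  moreover have "ln (t / s) \<ge> 0 \<longleftrightarrow> s \<le> t"
    using assms by (simp add: ln_div)
  ultimately show ?thesis
    using hdist_geo_point[OF assms] by (auto simp: signed_dist_def)
qed

section \<open>Inscribed circles and the shear\<close>

lemma hcircle_Int_geodesic:
  assumes "a \<noteq> b" "w \<in> hplane" "r > 0" and that: "t > 0"
  shows "geo_point a b t \<in> hcircle w r \<longleftrightarrow>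
    dist_sq w a / t + t * dist_sq w b = 2 * \<bar>bracket a b\<bar> * Im w * cosh r"
proof -
  have hp: "geo_point a b t \<in> hplane" using that assms geo_point_in_hplane by auto
  have "hdist w (geo_point a b t) = r \<longleftrightarrow> cosh (hdist w (geo_point a b t)) = cosh r"
    using hdist_nonneg[OF assms(2) hp] assms(3) by (metis arcosh_cosh_real less_imp_le)
  moreover have "2 * \<bar>bracket a b\<bar> * Im w \<noteq> 0" using assms by (simp add: hplane_def)
  then have "x / (2 * \<bar>bracket a b\<bar> * Im w) = y \<longleftrightarrow> x = 2 * \<bar>bracket a b\<bar> * Im w * y" for x y
    by (metis nonzero_divide_eq_eq mult.commute)
  ultimately show ?thesis
    using hp unfolding cosh_hdist_geo_point[OF assms(1) that assms(2)] hcircle_def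
    by simp
qed

text \<open>The equation \<open>A / t + t * B = c\<close> for the points common to circle and geodesic is invariant under
  \<open>t \<mapsto> A / (B * t)\<close>. A tangent point is the only solution, hence fixed by this involution:
  \<open>A = t\<^sup>2 * B\<close>. So the foot of the centre \<open>w\<close> has the same ratio of distances to \<open>a\<close> and \<open>b\<close> as
  \<open>w\<close> itself.\<close>

lemma tangent_hcircle_imp:
  assumes ab: "a \<noteq> b" and w: "w \<in> hplane" and r: "r > 0" and t: "t > 0"
    and C: "hcircle w r \<inter> geodesic a b = {geo_point a b t}"
  shows "dist_sq w a = t\<^sup>2 * dist_sq w b"
    and "dist_sq w a * dist_sq w b = (bracket a b * Im w * cosh r)\<^sup>2"
proof -
  let ?A = "dist_sq w a" and ?B = "dist_sq w b"
  have A: "?A > 0" and B: "?B > 0" using w by (auto intro: dist_sq_pos)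
  note on = hcircle_Int_geodesic[OF ab w r]
  have eq: "?A / t + t * ?B = 2 * \<bar>bracket a b\<bar> * Im w * cosh r"
    using C on[OF t] by auto
  define u where "u = ?A / (?B * t)"
  have u: "u > 0" using A B t by (simp add: u_def)
  have "?A / u + u * ?B = ?A / t + t * ?B"
    using A B t by (simp add: u_def)
  then have "geo_point a b u \<in> hcircle w r \<inter> geodesic a b"
    using eq on[OF u] geo_point_in_geodesic[OF ab u] by simp
  then have "u = t" using C geo_point_inject[OF ab u t] by simp
  then show 1: "?A = t\<^sup>2 * ?B" using B t by (simp add: u_def field_simps power2_eq_square)
  have "t * ?B = \<bar>bracket a b\<bar> * Im w * cosh r"
    using eq t unfolding 1 by (simp add: power2_eq_square)
  then have "(\<bar>bracket a b\<bar> * Im w * cosh r)\<^sup>2 = (t * ?B)\<^sup>2" by simp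
  then show "?A * ?B = (bracket a b * Im w * cosh r)\<^sup>2"
    unfolding 1 by (simp add: power_mult_distrib) (simp add: power2_eq_square)
qed

text \<open>Conversely, if the right hand side of \<open>A / t + t * B = c\<close> is the minimum \<open>2 * sqrt (A * B)\<close> of
  the left, the solution is unique.\<close>

lemma tangent_hcircle:
  assumes ab: "a \<noteq> b" and w: "w \<in> hplane" and r: "r > 0"
    and eq: "dist_sq w a * dist_sq w b = (bracket a b * Im w * cosh r)\<^sup>2"
  defines "t \<equiv> sqrt (dist_sq w a / dist_sq w b)"
  shows "hcircle w r \<inter> geodesic a b = {geo_point a b t}"
proof -
  let ?A = "dist_sq w a" and ?B = "dist_sq w b"
  define K where "K = \<bar>bracket a b\<bar> * Im w * cosh r"
  have A: "?A > 0" and B: "?B > 0" using w by (auto intro: dist_sq_pos)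
  have t: "t > 0" using A B by (simp add: t_def)
  have At: "?A = t\<^sup>2 * ?B" using A B by (simp add: t_def)
  have "K > 0" using ab w by (simp add: K_def hplane_def)
  moreover have "K\<^sup>2 = (t * ?B)\<^sup>2"
    using eq unfolding At K_def by (simp add: power_mult_distrib) (simp add: power2_eq_square)
  ultimately have K: "K = t * ?B" using t B by (simp add: power2_eq_iff_nonneg)
  note on = hcircle_Int_geodesic[OF ab w r, folded mult.assoc]
  have unique: "u = t" if u: "u > 0" "geo_point a b u \<in> hcircle w r" for u
  proof -
    have "?A / u + u * ?B = 2 * K"
      using on[OF u(1)] u(2) by (simp add: K_def mult.assoc)
    then have "?B * (t\<^sup>2 / u + u) = ?B * (2 * t)" unfolding At K
      by (simp add: algebra_simps)
    then have "t\<^sup>2 / u + u = 2 * t" using B by simp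
    then have "(t - u)\<^sup>2 = 0" using u(1) by (simp add: field_simps power2_eq_square)
    then show ?thesis by simp
  qed
  have "?A / t + t * ?B = 2 * K"
    unfolding K At using t by (simp add: power2_eq_square)
  then have "geo_point a b t \<in> hcircle w r \<inter> geodesic a b"
    using on[OF t] geo_point_in_geodesic[OF ab t] by (simp add: K_def mult.assoc)
  moreover have "hcircle w r \<inter> geodesic a b \<subseteq> {geo_point a b t}"
    using unique unfolding geodesic_eq_image[OF ab] by blast
  ultimately show ?thesis by blast
qed

text \<open>The incentre is the point whose pairings with the three null vectors of the vertices balance.
  The last equation says that the radius \<open>r\<close> of the inscribed circle of every ideal triangle
  satisfies \<open>cosh r = 2 / sqrt 3\<close>.\<close>

lemma incentre_exists:
  assumes "a \<noteq> b" "b \<noteq> c" "c \<noteq> a"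
  shows "\<exists>w\<in>hplane. \<exists>\<kappa>>0.
     dist_sq w a * (bracket b c)\<^sup>2 = \<kappa> \<and>
     dist_sq w b * (bracket c a)\<^sup>2 = \<kappa> \<and>
     dist_sq w c * (bracket a b)\<^sup>2 = \<kappa> \<and>
     3 * \<kappa>\<^sup>2 = 4 * (bracket a b * bracket b c * bracket c a * Im w)\<^sup>2"
    (is "?P a b c")
proof -
  have rot: "?P a b c" if rotated: "?P b c a" for a b c
  proof -
    obtain w \<kappa> where w: "w \<in> hplane" "\<kappa> > 0"
      and d: "dist_sq w a * (bracket b c)\<^sup>2 = \<kappa>" "dist_sq w b * (bracket c a)\<^sup>2 = \<kappa>"
        "dist_sq w c * (bracket a b)\<^sup>2 = \<kappa>"
      and V: "3 * \<kappa>\<^sup>2 = 4 * (bracket b c * bracket c a * bracket a b * Im w)\<^sup>2"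
      using rotated by blast
    have "bracket b c * bracket c a * bracket a b = bracket a b * bracket b c * bracket c a"
      by simp
    with w d V show ?thesis by metis
  qed
  have inf: "?P (Some x) (Some y) None" if "x \<noteq> y" for x y
  proof -
    \<comment> \<open>the incentre lies above the midpoint of the two finite vertices\<close>
    have s: "(sqrt 3 / 2 * \<bar>x - y\<bar>)\<^sup>2 = 3 / 4 * (x - y)\<^sup>2"
      by (simp add: power_mult_distrib power_divide)
    show ?thesis
      using that
      by (intro bexI[of _ "Complex ((x + y) / 2) (sqrt 3 / 2 * \<bar>x - y\<bar>)"] exI[of _ "(x - y)\<^sup>2"])
         (simp_all add: s power_mult_distrib hplane_def, simp_all add: power2_eq_square power4_eq_xxxx field_simps)
  qed
  have fin: "?P (Some x) (Some y) (Some z)" if "x \<noteq> y" "y \<noteq> z" "z \<noteq> x" for x y z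
  proof -
    \<comment> \<open>the sum of the null vectors of the vertices with weights \<open>(y - z)\<^sup>2\<close>, \<open>(z - x)\<^sup>2\<close>, \<open>(x - y)\<^sup>2\<close>
        is the vector of \<open>Complex X Y\<close>, up to scaling\<close>
    define S where "S = (x - y)\<^sup>2 + (y - z)\<^sup>2 + (z - x)\<^sup>2"
    define V where "V = (x - y) * (y - z) * (z - x)"
    define X where "X = (x * (y - z)\<^sup>2 + y * (z - x)\<^sup>2 + z * (x - y)\<^sup>2) / S"
    define Y where "Y = sqrt 3 * \<bar>V\<bar> / S"
    have S: "S > 0" using that by (simp add: S_def add_pos_nonneg)
    have V: "V \<noteq> 0" using that by (simp add: V_def)
    have Y: "Y > 0" using S V by (simp add: Y_def)
    have Y2: "Y\<^sup>2 = 3 * V\<^sup>2 / S\<^sup>2" by (simp add: Y_def power_mult_distrib power_divide)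
    have key: "((X - u)\<^sup>2 + Y\<^sup>2) * f\<^sup>2 = 2 * V\<^sup>2 / S"
      if N: "x * (y - z)\<^sup>2 + y * (z - x)\<^sup>2 + z * (x - y)\<^sup>2 - u * S = g * e"
        and gf: "V = g * f" and ef: "e\<^sup>2 + 3 * f\<^sup>2 = 2 * S" for u e f g
    proof -
      have "X - u = g * e / S"
        using S by (simp add: X_def N[symmetric] diff_divide_distrib)
      then have "((X - u)\<^sup>2 + Y\<^sup>2) * f\<^sup>2 = (g\<^sup>2 * f\<^sup>2) * (e\<^sup>2 + 3 * f\<^sup>2) / S\<^sup>2"
        unfolding Y2 gf by (simp add: power_divide power_mult_distrib add_divide_distrib[symmetric])
          (simp add: algebra_simps)
      also have "\<dots> = 2 * V\<^sup>2 / S"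
        unfolding ef gf using S by (simp add: power2_eq_square)
      finally show ?thesis .
    qed
    have "((X - x)\<^sup>2 + Y\<^sup>2) * (y - z)\<^sup>2 = 2 * V\<^sup>2 / S"
      by (rule key[where g = "(x - y) * (z - x)" and e = "2 * x - y - z"])
         (simp_all add: S_def V_def power2_eq_square algebra_simps)
    moreover have "((X - y)\<^sup>2 + Y\<^sup>2) * (z - x)\<^sup>2 = 2 * V\<^sup>2 / S"
      by (rule key[where g = "(x - y) * (y - z)" and e = "2 * y - z - x"])
         (simp_all add: S_def V_def power2_eq_square algebra_simps)
    moreover have "((X - z)\<^sup>2 + Y\<^sup>2) * (x - y)\<^sup>2 = 2 * V\<^sup>2 / S"
      by (rule key[where g = "(y - z) * (z - x)" and e = "2 * z - x - y"])
         (simp_all add: S_def V_def power2_eq_square algebra_simps)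
    moreover have "3 * (2 * V\<^sup>2 / S)\<^sup>2 = 4 * (V * Y)\<^sup>2"
      unfolding power_mult_distrib Y2 by (simp add: power_divide)
    moreover have "2 * V\<^sup>2 / S > 0" using V S by simp
    ultimately show ?thesis
      using Y by (intro bexI[of _ "Complex X Y"] exI[of _ "2 * V\<^sup>2 / S"])
        (simp_all add: hplane_def V_def)
  qed
  show ?thesis
  proof (cases "a = None \<or> b = None \<or> c = None")
    case True
    then consider x y where "a = Some x" "b = Some y" "c = None"
      | x y where "a = None" "b = Some x" "c = Some y"
      | x y where "a = Some x" "b = None" "c = Some y"
      using assms by (cases a; cases b; cases c) auto
    then show ?thesis
    proof cases
      case 1
      show ?thesis unfolding 1 by (rule inf) (use assms 1 in auto)
    next
      case 2
      show ?thesis unfolding 2 by (rule rot, rule inf) (use assms 2 in auto)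
    next
      case 3
      show ?thesis unfolding 3 by (rule rot, rule rot, rule inf) (use assms 3 in auto)
    qed
  next
    case False
    then obtain x y z where *: "a = Some x" "b = Some y" "c = Some z" by auto
    show ?thesis unfolding * by (rule fin) (use assms * in auto)
  qed
qed

lemma cosh_real_surj:
  assumes "x > (1::real)"
  shows "\<exists>r>0. cosh r = x"
proof (intro exI[of _ "arcosh x"] conjI)
  show *: "cosh (arcosh x) = x" using assms by simp
  have "arcosh x \<noteq> 0" using * assms by auto
  then show "arcosh x > 0" using arcosh_nonneg_real[of x] assms by simp
qed

lemma inscribed_circle_exists:
  assumes "a \<noteq> b" "b \<noteq> c" "c \<noteq> a"
  shows "\<exists>C. inscribed_circle a b c C"
proof -
  obtain w \<kappa> where w: "w \<in> hplane" and \<kappa>: "\<kappa> > 0"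
    and A: "dist_sq w a * (bracket b c)\<^sup>2 = \<kappa>"
    and B: "dist_sq w b * (bracket c a)\<^sup>2 = \<kappa>"
    and C: "dist_sq w c * (bracket a b)\<^sup>2 = \<kappa>"
    and V: "3 * \<kappa>\<^sup>2 = 4 * (bracket a b * bracket b c * bracket c a * Im w)\<^sup>2"
    using incentre_exists[OF assms] by blast
  have "2 / sqrt 3 > (1::real)"
    by (simp add: real_less_lsqrt less_divide_eq)
  then obtain r :: real where r: "r > 0" and cr: "cosh r = 2 / sqrt 3"
    using cosh_real_surj by blast
  then have cr2: "(cosh r)\<^sup>2 = 4 / 3" by (simp add: power_divide)
  have tan: "tangent (hcircle w r) (geodesic p q)"
    if "p \<noteq> q" "q \<noteq> s" "s \<noteq> p"
      "dist_sq w p * (bracket q s)\<^sup>2 = \<kappa>" "dist_sq w q * (bracket s p)\<^sup>2 = \<kappa>"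
      "3 * \<kappa>\<^sup>2 = 4 * (bracket p q * bracket q s * bracket s p * Im w)\<^sup>2" for p q s
  proof -
    let ?k = "(bracket q s * bracket s p)\<^sup>2"
    have "dist_sq w p * dist_sq w q * ?k =
        (dist_sq w p * (bracket q s)\<^sup>2) * (dist_sq w q * (bracket s p)\<^sup>2)"
      by (simp add: power_mult_distrib)
    also have "\<dots> = \<kappa>\<^sup>2" unfolding that(4,5) by (simp add: power2_eq_square)
    also have "\<dots> = (bracket p q * Im w * cosh r)\<^sup>2 * ?k"
      using that(6) by (simp add: power_mult_distrib cr2 algebra_simps)
    finally have "dist_sq w p * dist_sq w q = (bracket p q * Im w * cosh r)\<^sup>2"
      using that(1-3) by simp
    from tangent_hcircle[OF that(1) w r this] show ?thesis
      by (auto simp: tangent_def)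
  qed
  have "inscribed_circle a b c (hcircle w r)"
    unfolding inscribed_circle_def
    using tan[of a b c] tan[of b c a] tan[of c a b] assms A B C V w r
    by (auto simp: mult_ac)
  then show ?thesis by blast
qed

text \<open>Tangency to all three sides makes \<open>dist_sq w a * (bracket b c)\<^sup>2\<close> invariant under permutation of
  the vertices. So the centre has the ratio of distances to \<open>a\<close> and \<open>b\<close> given here, and by
  \<open>tangent_hcircle_imp\<close> the touching point shares it.\<close>

lemma inscribed_circle_touch:
  assumes abc: "a \<noteq> b" "b \<noteq> c" "c \<noteq> a"
    and C: "inscribed_circle a b c C"
  shows "C \<inter> geodesic a b = {geo_point a b (\<bar>bracket a c\<bar> / \<bar>bracket b c\<bar>)}"
proof -
  obtain w r where w: "w \<in> hplane" and r: "r > 0" and Ceq: "C = hcircle w r"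
    and tan: "tangent C (geodesic a b)" "tangent C (geodesic b c)" "tangent C (geodesic c a)"
    using C unfolding inscribed_circle_def by blast
  have ex: "\<exists>t>0. C \<inter> geodesic p q = {geo_point p q t}"
    if pq: "tangent C (geodesic p q)" "p \<noteq> q" for p q
  proof -
    obtain z where z: "C \<inter> geodesic p q = {z}" using pq(1) unfolding tangent_def by blast
    then have "z \<in> geodesic p q" by auto
    with z show ?thesis unfolding geodesic_eq_image[OF pq(2)] by force
  qed
  obtain t where t: "t > 0" "C \<inter> geodesic a b = {geo_point a b t}"
    using ex[OF tan(1) abc(1)] by auto
  obtain u where u: "u > 0" "C \<inter> geodesic b c = {geo_point b c u}"
    using ex[OF tan(2) abc(2)] by auto
  obtain v where v: "v > 0" "C \<inter> geodesic c a = {geo_point c a v}"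
    using ex[OF tan(3) abc(3)] by auto
  note ta = tangent_hcircle_imp[OF abc(1) w r t[unfolded Ceq]]
  note tb = tangent_hcircle_imp[OF abc(2) w r u[unfolded Ceq]]
  note tc = tangent_hcircle_imp[OF abc(3) w r v[unfolded Ceq]]
  have c: "dist_sq w c > 0" and b: "dist_sq w b > 0" using w by (auto intro: dist_sq_pos)
  define k where "k = Im w * cosh r"
  have k: "k > 0" using w by (simp add: k_def hplane_def)
  have "dist_sq w c * (dist_sq w a * (bracket b c)\<^sup>2) * k\<^sup>2
      = dist_sq w c * (dist_sq w b * (bracket c a)\<^sup>2) * k\<^sup>2"
    using tb(2) tc(2) unfolding mult.assoc[of _ "Im w"] k_def[symmetric] power_mult_distrib
    by (metis mult.assoc mult.commute)
  then have "t\<^sup>2 * (bracket b c)\<^sup>2 = (bracket c a)\<^sup>2"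
    unfolding ta(1) using b c k by simp
  then have "(t * \<bar>bracket b c\<bar>)\<^sup>2 = \<bar>bracket c a\<bar>\<^sup>2" by (simp add: power_mult_distrib)
  then have "t * \<bar>bracket b c\<bar> = \<bar>bracket a c\<bar>"
    using t by (subst (asm) power2_eq_iff_nonneg) (auto simp: abs_bracket_commute)
  then have "t = \<bar>bracket a c\<bar> / \<bar>bracket b c\<bar>" using abc by (simp add: field_simps)
  then show ?thesis using t by simp
qed

lemma touching_point_eq:
  assumes "a \<noteq> b" "b \<noteq> c" "c \<noteq> a"
  shows "touching_point a b c = geo_point a b (\<bar>bracket a c\<bar> / \<bar>bracket b c\<bar>)"
  unfolding touching_point_def
  using inscribed_circle_exists[OF assms] inscribed_circle_touch[OF assms]
  by (intro the_equality) auto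

lemma shear_eq:
  assumes "a \<noteq> b" "b \<noteq> c" "c \<noteq> a" "b \<noteq> d" "d \<noteq> a"
  shows "shear a b c d = ln ((\<bar>bracket a d\<bar> * \<bar>bracket b c\<bar>) / (\<bar>bracket a c\<bar> * \<bar>bracket b d\<bar>))"
  using assms unfolding shear_def
  by (subst (1 2) touching_point_eq) (simp_all add: signed_dist_geo_point)

section \<open>Lambda lengths of a decoration\<close>

text \<open>The constant \<open>u\<close> for which the horocycle of size \<open>k\<close> at \<open>a\<close> is the set \<open>u * dist_sq z a = Im z\<close>.\<close>

fun horo_weight :: "rhat \<Rightarrow> real \<Rightarrow> real" where
  "horo_weight (Some x) k = 1 / (2 * k)"
| "horo_weight None k = k"

lemma horo_weight_pos: "k > 0 \<Longrightarrow> horo_weight a k > 0"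
  by (cases a) auto

lemma horocycle_eq:
  assumes "k > 0"
  shows "horocycle a k = {z \<in> hplane. horo_weight a k * dist_sq z a = Im z}"
    and "horodisk a k = {z \<in> hplane. horo_weight a k * dist_sq z a < Im z}"
proof -
  have "(cmod (z - Complex x k) = k \<longleftrightarrow> (Re z - x)\<^sup>2 + (Im z)\<^sup>2 = 2 * k * Im z) \<and>
        (cmod (z - Complex x k) < k \<longleftrightarrow> (Re z - x)\<^sup>2 + (Im z)\<^sup>2 < 2 * k * Im z)" for z x
  proof -
    have "(cmod (z - Complex x k))\<^sup>2 - k\<^sup>2 = (Re z - x)\<^sup>2 + (Im z)\<^sup>2 - 2 * k * Im z"
      unfolding cmod_power2 by (simp add: power2_eq_square algebra_simps)
    moreover have "cmod (z - Complex x k) = k \<longleftrightarrow> (cmod (z - Complex x k))\<^sup>2 = k\<^sup>2"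
        "cmod (z - Complex x k) < k \<longleftrightarrow> (cmod (z - Complex x k))\<^sup>2 < k\<^sup>2"
      using assms by (simp add: power2_eq_iff_nonneg)
        (metis assms less_imp_le norm_ge_zero power2_less_imp_less power_strict_mono zero_less_numeral)
    ultimately show ?thesis by linarith
  qed
  then show "horocycle a k = {z \<in> hplane. horo_weight a k * dist_sq z a = Im z}"
    and "horodisk a k = {z \<in> hplane. horo_weight a k * dist_sq z a < Im z}"
    using assms by (cases a; auto simp: field_simps)+
qed

lemma horocycle_point_eq:
  assumes "a \<noteq> b" "k a > 0"
  shows "horocycle_point k a b = geo_point a b (1 / (\<bar>bracket a b\<bar> * horo_weight a (k a)))"
proof -
  let ?u = "horo_weight a (k a)"
  have u: "?u > 0" using assms by (rule_tac horo_weight_pos)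
  have W: "\<bar>bracket a b\<bar> > 0" using assms by simp
  define t where "t = 1 / (\<bar>bracket a b\<bar> * ?u)"
  have t: "t > 0" using u W by (simp add: t_def)
  have on: "geo_point a b s \<in> horocycle a (k a) \<longleftrightarrow> s = t" if s: "s > 0" for s
  proof -
    have hp: "geo_point a b s \<in> hplane" "Im (geo_point a b s) > 0"
      using geo_point_in_hplane[OF assms(1) s] by (auto simp: hplane_def)
    have "geo_point a b s \<in> horocycle a (k a) \<longleftrightarrow> ?u * (s * \<bar>bracket a b\<bar>) = 1"
      unfolding horocycle_eq(1)[OF assms(2)] using hp
      by (simp add: dist_sq_geo_point_left[OF assms(1) s] flip: mult.assoc)
    also have "\<dots> \<longleftrightarrow> s = t"
      using u W by (simp add: t_def eq_divide_eq mult_ac)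
    finally show ?thesis .
  qed
  have "geodesic a b \<inter> horocycle a (k a) = {geo_point a b t}"
    unfolding geodesic_eq_image[OF assms(1)] using on t by force
  then show ?thesis by (simp add: horocycle_point_def t_def)
qed

text \<open>This is \<open>cosh d \<ge> 1\<close> for the distance \<open>d\<close> from \<open>z\<close> to its foot on the geodesic.\<close>

lemma dist_sq_mult_ge:
  assumes "a \<noteq> b" "z \<in> hplane"
  shows "dist_sq z a * dist_sq z b \<ge> (bracket a b)\<^sup>2 * (Im z)\<^sup>2"
proof -
  let ?A = "dist_sq z a" and ?B = "dist_sq z b"
  have A: "?A > 0" and B: "?B > 0" using assms by (auto intro: dist_sq_pos)
  define t where "t = sqrt (?A / ?B)"
  have t: "t > 0" using A B by (simp add: t_def)
  have At: "?A = t\<^sup>2 * ?B" using A B by (simp add: t_def)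
  have K: "2 * \<bar>bracket a b\<bar> * Im z > 0" using assms by (simp add: hplane_def)
  have "1 \<le> (?A / t + t * ?B) / (2 * \<bar>bracket a b\<bar> * Im z)"
    unfolding cosh_hdist_geo_point[OF assms(1) t assms(2), symmetric] by (rule cosh_real_ge_1)
  then have "2 * \<bar>bracket a b\<bar> * Im z \<le> ?A / t + t * ?B"
    using K by (simp only: le_divide_eq_1_pos)
  also have "\<dots> = 2 * (t * ?B)" unfolding At using t by (simp add: power2_eq_square)
  finally have "(\<bar>bracket a b\<bar> * Im z)\<^sup>2 \<le> (t * ?B)\<^sup>2"
    using assms(2) by (intro power_mono) (auto simp: hplane_def)
  then show ?thesis unfolding At by (simp add: power_mult_distrib) (simp add: power2_eq_square mult_ac)
qed

text \<open>The geodesic joining the base points consists of the points where equality holds in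
  \<open>dist_sq_mult_ge\<close>. So if the two horodisks meet at all, they meet on this geodesic, where they cut
  out the rays \<open>t < 1 / (\<bar>W\<bar> * u)\<close> and \<open>t > \<bar>W\<bar> * v\<close>.\<close>

lemma horodisk_disjoint_iff:
  assumes "a \<noteq> b" "k > 0" "l > 0"
  shows "horodisk a k \<inter> horodisk b l = {} \<longleftrightarrow>
    (bracket a b)\<^sup>2 * horo_weight a k * horo_weight b l \<ge> 1"
proof -
  let ?u = "horo_weight a k" and ?v = "horo_weight b l" and ?W = "\<bar>bracket a b\<bar>"
  have u: "?u > 0" and v: "?v > 0" using assms horo_weight_pos by auto
  have W: "?W > 0" using assms by simp
  have "(bracket a b)\<^sup>2 * ?u * ?v < 1" if "z \<in> horodisk a k \<inter> horodisk b l" for z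
  proof -
    have z: "z \<in> hplane" "?u * dist_sq z a < Im z" "?v * dist_sq z b < Im z"
      using that assms by (auto simp: horocycle_eq)
    then have Im: "Im z > 0" by (simp add: hplane_def)
    have "(bracket a b)\<^sup>2 * ?u * ?v * (Im z)\<^sup>2 = ?u * ?v * ((bracket a b)\<^sup>2 * (Im z)\<^sup>2)" by simp
    also have "\<dots> \<le> ?u * ?v * (dist_sq z a * dist_sq z b)"
      using dist_sq_mult_ge[OF assms(1) z(1)] u v by (intro mult_left_mono) auto
    also have "\<dots> = (?u * dist_sq z a) * (?v * dist_sq z b)" by simp
    also have "\<dots> < Im z * Im z"
      using z Im u v dist_sq_pos[OF z(1)] by (intro mult_strict_mono) (auto intro: less_imp_le mult_pos_pos)
    finally show ?thesis using Im by (simp add: power2_eq_square)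
  qed
  moreover have "horodisk a k \<inter> horodisk b l \<noteq> {}" if "(bracket a b)\<^sup>2 * ?u * ?v < 1"
  proof -
    have "?W * ?v < 1 / (?W * ?u)"
      using that W u by (simp add: less_divide_eq power2_eq_square mult_ac)
    then obtain t where t: "?W * ?v < t" "t < 1 / (?W * ?u)" using dense by blast
    have t0: "t > 0" using t(1) W v by (meson less_trans mult_pos_pos)
    have hp: "geo_point a b t \<in> hplane" "Im (geo_point a b t) > 0"
      using geo_point_in_hplane[OF assms(1) t0] by (auto simp: hplane_def)
    have "?u * (t * ?W) < 1" "?v * (?W / t) < 1"
      using t t0 W u by (simp_all add: field_simps)
    then have "?u * (t * ?W) * Im (geo_point a b t) < Im (geo_point a b t)"
        "?v * (?W / t) * Im (geo_point a b t) < Im (geo_point a b t)"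
      using hp(2) by (simp_all only: mult_less_cancel_right2) auto
    then have "geo_point a b t \<in> horodisk a k \<inter> horodisk b l"
      using hp assms by (simp add: horocycle_eq dist_sq_geo_point_left dist_sq_geo_point_right t0 mult_ac)
    then show ?thesis by blast
  qed
  ultimately show ?thesis by (meson equals0I not_le)
qed

lemma horocycle_dist_eq:
  assumes "a \<noteq> b" "k a > 0" "k b > 0"
  shows "horocycle_dist k a b = ln ((bracket a b)\<^sup>2 * horo_weight a (k a) * horo_weight b (k b))"
proof -
  let ?u = "horo_weight a (k a)" and ?v = "horo_weight b (k b)" and ?W = "\<bar>bracket a b\<bar>"
  have u: "?u > 0" and v: "?v > 0" using assms horo_weight_pos by auto
  have W: "?W > 0" using assms by simp
  have "horocycle_point k b a = geo_point b a (1 / (?W * ?v))"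
    using horocycle_point_eq[of b a k] assms by (simp add: abs_bracket_commute[of a b])
  also have "\<dots> = geo_point a b (?W * ?v)"
    using W v by (intro geo_point_flip) simp
  finally have "hdist (horocycle_point k a b) (horocycle_point k b a) =
      \<bar>ln (?W * ?v / (1 / (?W * ?u)))\<bar>"
    using assms u v W by (simp add: horocycle_point_eq hdist_geo_point)
  also have "?W * ?v / (1 / (?W * ?u)) = ?W * ?W * ?u * ?v"
    by simp
  also have "\<dots> = (bracket a b)\<^sup>2 * ?u * ?v" by (simp add: power2_eq_square)
  finally have d: "hdist (horocycle_point k a b) (horocycle_point k b a) =
      \<bar>ln ((bracket a b)\<^sup>2 * ?u * ?v)\<bar>" .
  have "(bracket a b)\<^sup>2 * ?u * ?v > 0" using assms u v by simp
  then show ?thesis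
    unfolding horocycle_dist_def Let_def d horodisk_disjoint_iff[OF assms]
    by (auto simp: ln_ge_zero_iff abs_if not_le)
qed

lemma ln_lambda_length:
  assumes "a \<noteq> b" "k a > 0" "k b > 0"
  shows "ln (lambda_length k a b) =
    ln \<bar>bracket a b\<bar> + (ln (horo_weight a (k a)) + ln (horo_weight b (k b))) / 2"
proof -
  have u: "horo_weight a (k a) > 0" and v: "horo_weight b (k b) > 0"
    using assms horo_weight_pos by auto
  have W: "bracket a b \<noteq> 0" using assms by simp
  have "ln ((bracket a b)\<^sup>2) = 2 * ln \<bar>bracket a b\<bar>"
    using W by (metis ln_realpow abs_not_less_zero not_less_iff_gr_or_eq of_nat_numeral power2_abs zero_less_abs_iff)
  then show ?thesis
    using u v W by (simp add: lambda_length_def horocycle_dist_eq[OF assms] ln_sqrt ln_mult)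
qed

section \<open>The reflection group in homogeneous coordinates\<close>

text \<open>The boundary point with homogeneous coordinates \<open>(x, y)\<close>. In these coordinates the generating
  reflections are linear, and the cyclic order is a sign of a product of determinants, so
  statements about them become polynomial identities.\<close>

definition proj_pt :: "real \<Rightarrow> real \<Rightarrow> rhat" where
  "proj_pt x y = (if y = 0 then None else Some (x / y))"

lemma proj_pt_cases:
  obtains x y where "p = proj_pt x y" "x \<noteq> 0 \<or> y \<noteq> 0"
proof (cases p)
  case None
  then show ?thesis using that[of 1 0] by (simp add: proj_pt_def)
next
  case (Some x)
  then show ?thesis using that[of x 1] by (simp add: proj_pt_def)
qed

lemma proj_pt_eq_iff:
  assumes "x \<noteq> 0 \<or> y \<noteq> 0" "x' \<noteq> 0 \<or> y' \<noteq> 0"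
  shows "proj_pt x y = proj_pt x' y' \<longleftrightarrow> x * y' = x' * y"
  using assms by (auto simp: proj_pt_def field_simps)

lemma zero_less_mult_iff_pos: "a > 0 \<Longrightarrow> 0 < a * b \<longleftrightarrow> 0 < (b :: real)"
  by (simp add: zero_less_mult_iff)

lemma ccw_proj_pt:
  assumes "x1 \<noteq> 0 \<or> y1 \<noteq> 0" "x2 \<noteq> 0 \<or> y2 \<noteq> 0" "x3 \<noteq> 0 \<or> y3 \<noteq> 0"
  shows "ccw (proj_pt x1 y1) (proj_pt x2 y2) (proj_pt x3 y3) \<longleftrightarrow>
    (x1 * y2 - x2 * y1) * (x2 * y3 - x3 * y2) * (x3 * y1 - x1 * y3) > 0"
proof -
  \<comment> \<open>the factor by which \<open>(x, y)\<close> differs from the normalized coordinates; it occurs squared\<close>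
  define s :: "real \<Rightarrow> real \<Rightarrow> real" where "s x y = (if y = 0 then x else y)" for x y
  have nz: "s x1 y1 \<noteq> 0" "s x2 y2 \<noteq> 0" "s x3 y3 \<noteq> 0" using assms by (auto simp: s_def)
  have br: "x * y' - x' * y = s x y * s x' y' * bracket (proj_pt x y) (proj_pt x' y')" for x y x' y'
    by (auto simp: proj_pt_def s_def field_simps)
  have "(x1 * y2 - x2 * y1) * (x2 * y3 - x3 * y2) * (x3 * y1 - x1 * y3) =
    (s x1 y1 * s x2 y2 * s x3 y3)\<^sup>2 * (bracket (proj_pt x1 y1) (proj_pt x2 y2) *
      bracket (proj_pt x2 y2) (proj_pt x3 y3) * bracket (proj_pt x3 y3) (proj_pt x1 y1))"
    unfolding br by (simp add: power2_eq_square mult_ac)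
  moreover have "(s x1 y1 * s x2 y2 * s x3 y3)\<^sup>2 > 0" using nz by simp
  ultimately show ?thesis unfolding ccw_iff_bracket by (simp only: zero_less_mult_iff_pos)
qed

text \<open>The rotation \<open>t \<mapsto> 1 / (1 - t)\<close> of order three that permutes \<open>0\<close>, \<open>1\<close> and \<open>\<infinity>\<close> cyclically. These
  points lie in different orbits of the reflection group; the rotation normalizes the group and
  identifies the orbits.\<close>

fun rot :: "rhat \<Rightarrow> rhat" where
  "rot None = Some 0"
| "rot (Some t) = (if t = 1 then None else Some (1 / (1 - t)))"

lemma reflect_commute: "reflect a b = reflect b a"
proof
  fix t
  have sq: "((x - y) / 2)\<^sup>2 = ((y - x) / 2)\<^sup>2" for x y :: real
    by (simp add: power_divide power2_commute)
  show "reflect a b t = reflect b a t"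
  proof (cases a; cases b)
    fix x y assume "a = Some x" "b = Some y"
    then show ?thesis using sq[of x y] add.commute[of x y] by (cases t) (simp_all only: reflect.simps)
  qed simp_all
qed

lemma reflect_proj_pt:
  shows "reflect (Some 0) None (proj_pt x y) = proj_pt (- x) y"
    and "reflect (Some 1) None (proj_pt x y) = proj_pt (2 * y - x) y"
    and "x \<noteq> 0 \<or> y \<noteq> 0 \<Longrightarrow> reflect (Some 0) (Some 1) (proj_pt x y) = proj_pt x (2 * x - y)"
proof -
  show "reflect (Some 0) None (proj_pt x y) = proj_pt (- x) y"
    "reflect (Some 1) None (proj_pt x y) = proj_pt (2 * y - x) y"
    by (auto simp: proj_pt_def diff_divide_distrib)
  assume nz: "x \<noteq> 0 \<or> y \<noteq> 0"
  show "reflect (Some 0) (Some 1) (proj_pt x y) = proj_pt x (2 * x - y)"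
  proof (cases "y = 0")
    case False
    have "1 / 2 + (1 / 2)\<^sup>2 / (x / y - 1 / 2) = x / (2 * x - y)" if "2 * x - y \<noteq> 0"
    proof -
      have "x / y - 1 / 2 = (2 * x - y) / (2 * y)" using False by (simp add: field_simps)
      then show ?thesis using that False by (simp add: field_simps power2_eq_square)
    qed
    moreover have "x / y = 1 / 2 \<longleftrightarrow> 2 * x - y = 0" using False by (auto simp: field_simps)
    ultimately show ?thesis using False by (simp add: proj_pt_def)
  qed (use nz in \<open>simp add: proj_pt_def\<close>)
qed

lemma rot_proj_pt: "x \<noteq> 0 \<or> y \<noteq> 0 \<Longrightarrow> rot (proj_pt x y) = proj_pt y (y - x)"
  by (auto simp: proj_pt_def field_simps)

lemma farey_generator_cases:
  assumes "a \<in> {Some 0, Some 1, None}" "b \<in> {Some 0, Some 1, None}" "a \<noteq> b"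
    and "P (reflect (Some 0) None)" "P (reflect (Some 1) None)" "P (reflect (Some 0) (Some 1))"
  shows "P (reflect a b)"
  using assms reflect_commute[of "Some 0" None] reflect_commute[of "Some 1" None]
    reflect_commute[of "Some 0" "Some 1"] by auto

lemma reflect_reflect:
  assumes "a \<in> {Some 0, Some 1, None}" "b \<in> {Some 0, Some 1, None}" "a \<noteq> b"
  shows "reflect a b (reflect a b p) = p"
proof -
  obtain x y where p: "p = proj_pt x y" "x \<noteq> 0 \<or> y \<noteq> 0" by (rule proj_pt_cases)
  show ?thesis
    by (rule farey_generator_cases[OF assms, where P = "\<lambda>f. f (f p) = p"])
       (use p in \<open>auto simp: reflect_proj_pt proj_pt_eq_iff simp del: reflect.simps\<close>)
qed

lemma ccw_reflect:
  assumes "a \<in> {Some 0, Some 1, None}" "b \<in> {Some 0, Some 1, None}" "a \<noteq> b"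
  shows "ccw (reflect a b p) (reflect a b q) (reflect a b r) \<longleftrightarrow> ccw r q p"
proof -
  obtain x1 y1 where p: "p = proj_pt x1 y1" "x1 \<noteq> 0 \<or> y1 \<noteq> 0" by (rule proj_pt_cases)
  obtain x2 y2 where q: "q = proj_pt x2 y2" "x2 \<noteq> 0 \<or> y2 \<noteq> 0" by (rule proj_pt_cases)
  obtain x3 y3 where r: "r = proj_pt x3 y3" "x3 \<noteq> 0 \<or> y3 \<noteq> 0" by (rule proj_pt_cases)
  note nz = p(2) q(2) r(2)
  let ?d = "\<lambda>x1 y1 x2 y2 x3 y3 :: real.
    (x1 * y2 - x2 * y1) * (x2 * y3 - x3 * y2) * (x3 * y1 - x1 * y3)"
  show ?thesis unfolding p(1) q(1) r(1)
  proof (rule farey_generator_cases[OF assms])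
    have "?d (- x1) y1 (- x2) y2 (- x3) y3 = ?d x3 y3 x2 y2 x1 y1"
      by (simp add: algebra_simps)
    moreover have nz': "- x \<noteq> 0 \<or> y \<noteq> 0" if "x \<noteq> 0 \<or> y \<noteq> 0" for x y :: real using that by auto
    ultimately show "ccw (reflect (Some 0) None (proj_pt x1 y1)) (reflect (Some 0) None (proj_pt x2 y2))
       (reflect (Some 0) None (proj_pt x3 y3)) \<longleftrightarrow> ccw (proj_pt x3 y3) (proj_pt x2 y2) (proj_pt x1 y1)"
      unfolding reflect_proj_pt(1) ccw_proj_pt[OF nz'[OF nz(1)] nz'[OF nz(2)] nz'[OF nz(3)]] ccw_proj_pt[OF nz(3,2,1)]
      by (simp add: mult_ac)
    have "?d (2 * y1 - x1) y1 (2 * y2 - x2) y2 (2 * y3 - x3) y3 = ?d x3 y3 x2 y2 x1 y1"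
      by (simp add: algebra_simps)
    moreover have nz': "2 * y - x \<noteq> 0 \<or> y \<noteq> 0" if "x \<noteq> 0 \<or> y \<noteq> 0" for x y :: real using that by auto
    ultimately show "ccw (reflect (Some 1) None (proj_pt x1 y1)) (reflect (Some 1) None (proj_pt x2 y2))
       (reflect (Some 1) None (proj_pt x3 y3)) \<longleftrightarrow> ccw (proj_pt x3 y3) (proj_pt x2 y2) (proj_pt x1 y1)"
      unfolding reflect_proj_pt(2) ccw_proj_pt[OF nz'[OF nz(1)] nz'[OF nz(2)] nz'[OF nz(3)]] ccw_proj_pt[OF nz(3,2,1)]
      by (simp add: mult_ac)
    have "?d x1 (2 * x1 - y1) x2 (2 * x2 - y2) x3 (2 * x3 - y3) = ?d x3 y3 x2 y2 x1 y1"
      by (simp add: algebra_simps)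
    moreover have nz': "x \<noteq> 0 \<or> 2 * x - y \<noteq> 0" if "x \<noteq> 0 \<or> y \<noteq> 0" for x y :: real using that by auto
    ultimately show "ccw (reflect (Some 0) (Some 1) (proj_pt x1 y1)) (reflect (Some 0) (Some 1) (proj_pt x2 y2))
       (reflect (Some 0) (Some 1) (proj_pt x3 y3)) \<longleftrightarrow> ccw (proj_pt x3 y3) (proj_pt x2 y2) (proj_pt x1 y1)"
      unfolding reflect_proj_pt(3)[OF nz(1)] reflect_proj_pt(3)[OF nz(2)] reflect_proj_pt(3)[OF nz(3)]
        ccw_proj_pt[OF nz'[OF nz(1)] nz'[OF nz(2)] nz'[OF nz(3)]] ccw_proj_pt[OF nz(3,2,1)]
      by (simp add: mult_ac)
  qed
qed

lemma rot_rot_rot: "rot (rot (rot p)) = p"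
  by (cases p) (auto simp: field_simps)

lemma ccw_rot: "ccw (rot p) (rot q) (rot r) \<longleftrightarrow> ccw p q r"
proof -
  obtain x1 y1 where p: "p = proj_pt x1 y1" "x1 \<noteq> 0 \<or> y1 \<noteq> 0" by (rule proj_pt_cases)
  obtain x2 y2 where q: "q = proj_pt x2 y2" "x2 \<noteq> 0 \<or> y2 \<noteq> 0" by (rule proj_pt_cases)
  obtain x3 y3 where r: "r = proj_pt x3 y3" "x3 \<noteq> 0 \<or> y3 \<noteq> 0" by (rule proj_pt_cases)
  have "y1 * (y2 - x2) - y2 * (y1 - x1) = x1 * y2 - x2 * y1"
       "y2 * (y3 - x3) - y3 * (y2 - x2) = x2 * y3 - x3 * y2"
       "y3 * (y1 - x1) - y1 * (y3 - x3) = x3 * y1 - x1 * y3"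
    by (simp_all add: algebra_simps)
  moreover have nz': "y \<noteq> 0 \<or> y - x \<noteq> 0" if "x \<noteq> 0 \<or> y \<noteq> 0" for x y :: real using that by auto
  ultimately show ?thesis
    unfolding p(1) q(1) r(1) rot_proj_pt[OF p(2)] rot_proj_pt[OF q(2)] rot_proj_pt[OF r(2)]
      ccw_proj_pt[OF nz'[OF p(2)] nz'[OF q(2)] nz'[OF r(2)]] ccw_proj_pt[OF p(2) q(2) r(2)]
    by simp
qed

lemma rot_reflect:
  assumes "a \<in> {Some 0, Some 1, None}" "b \<in> {Some 0, Some 1, None}" "a \<noteq> b"
  shows "rot (reflect a b p) = reflect (rot a) (rot b) (rot p)"
proof -
  obtain x y where p: "p = proj_pt x y" "x \<noteq> 0 \<or> y \<noteq> 0" by (rule proj_pt_cases)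
  have nz: "x \<noteq> 0 \<or> 2 * x - y \<noteq> 0" "2 * y - x \<noteq> 0 \<or> y \<noteq> 0" "y \<noteq> 0 \<or> y - x \<noteq> 0"
    using p(2) by auto
  have 1: "rot (reflect (Some 0) None p) = reflect (Some 1) (Some 0) (rot p)"
    unfolding reflect_commute[of "Some 1" "Some 0"] p(1)
    using p nz by (simp add: reflect_proj_pt rot_proj_pt proj_pt_eq_iff del: reflect.simps; simp add: algebra_simps)
  have 2: "rot (reflect (Some 1) None p) = reflect None (Some 0) (rot p)"
    unfolding reflect_commute[of None "Some 0"] p(1)
    using p nz by (simp add: reflect_proj_pt rot_proj_pt proj_pt_eq_iff del: reflect.simps; simp add: algebra_simps)
  have 3: "rot (reflect (Some 0) (Some 1) p) = reflect (Some 1) None (rot p)"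
  proof -
    have "proj_pt (2 * x - y) (2 * x - y - x) = proj_pt (2 * (y - x) - y) (y - x)"
      using p(2) by (subst proj_pt_eq_iff) (auto simp: algebra_simps)
    then show ?thesis
      unfolding p(1) reflect_proj_pt(3)[OF p(2)] rot_proj_pt[OF p(2)] rot_proj_pt[OF nz(1)] reflect_proj_pt(2) .
  qed
  show ?thesis
    using assms 1 2 3 reflect_commute[of "Some 0" None] reflect_commute[of "Some 1" None]
     reflect_commute[of "Some 0" "Some 1"] by auto
qed

section \<open>Symmetries of the Farey triangulation\<close>

text \<open>Symmetries are characterized by what they preserve, so that reflections, the rotation and their
  composites need no common normal form. They may reverse the orientation.\<close>

definition farey_sym :: "(rhat \<Rightarrow> rhat) \<Rightarrow> bool" where
  "farey_sym g \<longleftrightarrow> bij g \<and> (\<forall>T. g ` T \<in> farey_triangles \<longleftrightarrow> T \<in> farey_triangles) \<and>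
     ((\<forall>a b c. ccw (g a) (g b) (g c) \<longleftrightarrow> ccw a b c) \<or> (\<forall>a b c. ccw (g a) (g b) (g c) \<longleftrightarrow> ccw c b a))"

lemma farey_sym_id: "farey_sym id"
  by (simp add: farey_sym_def)

lemma farey_sym_comp:
  assumes "farey_sym f" "farey_sym g"
  shows "farey_sym (f \<circ> g)"
proof -
  have "(f \<circ> g) ` T \<in> farey_triangles \<longleftrightarrow> T \<in> farey_triangles" for T
    using assms by (simp only: farey_sym_def image_comp[symmetric])
  moreover have "bij (f \<circ> g)" using assms by (simp add: farey_sym_def bij_comp)
  moreover have "(\<forall>a b c. ccw (f a) (f b) (f c) \<longleftrightarrow> ccw a b c) \<or>
      (\<forall>a b c. ccw (f a) (f b) (f c) \<longleftrightarrow> ccw c b a)"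
      "(\<forall>a b c. ccw (g a) (g b) (g c) \<longleftrightarrow> ccw a b c) \<or>
      (\<forall>a b c. ccw (g a) (g b) (g c) \<longleftrightarrow> ccw c b a)"
    using assms by (simp_all only: farey_sym_def)
  then have "(\<forall>a b c. ccw ((f \<circ> g) a) ((f \<circ> g) b) ((f \<circ> g) c) \<longleftrightarrow> ccw a b c) \<or>
      (\<forall>a b c. ccw ((f \<circ> g) a) ((f \<circ> g) b) ((f \<circ> g) c) \<longleftrightarrow> ccw c b a)"
    by (elim disjE) (simp_all only: comp_apply simp_thms)
  ultimately show ?thesis unfolding farey_sym_def by blast
qed

lemma farey_sym_reflect:
  assumes "a \<in> {Some 0, Some 1, None}" "b \<in> {Some 0, Some 1, None}" "a \<noteq> b"
  shows "farey_sym (reflect a b)"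
proof -
  note rr = reflect_reflect[OF assms]
  have "reflect a b ` T \<in> farey_triangles \<longleftrightarrow> T \<in> farey_triangles" for T
  proof
    assume "reflect a b ` T \<in> farey_triangles"
    then have "reflect a b ` reflect a b ` T \<in> farey_triangles" using farey_triangles.step[OF _ assms] by blast
    then show "T \<in> farey_triangles" by (simp add: image_image rr)
  next
    assume "T \<in> farey_triangles"
    then show "reflect a b ` T \<in> farey_triangles" using farey_triangles.step[OF _ assms] by blast
  qed
  moreover have "bij (reflect a b)" using rr by (rule involuntory_imp_bij)
  ultimately show ?thesis using ccw_reflect[OF assms] by (simp add: farey_sym_def)
qed

lemma farey_sym_rot: "farey_sym rot"
proof -
  have *: "rot ` T \<in> farey_triangles" if "T \<in> farey_triangles" for T
    using that
  proof induction
    case base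
    have "rot ` {Some 0, Some 1, None} = {Some 0, Some 1, None}" by auto
    then show ?case using farey_triangles.base by simp
  next
    case (step T a b)
    have "rot ` reflect a b ` T = reflect (rot a) (rot b) ` rot ` T"
      using rot_reflect[OF step.hyps(2-4)] by (simp add: image_image)
    moreover have "rot a \<noteq> rot b" using step.hyps(4) rot_rot_rot by metis
    moreover have "rot a \<in> {Some 0, Some 1, None}" "rot b \<in> {Some 0, Some 1, None}"
      using step.hyps(2,3) by auto
    ultimately show ?case using farey_triangles.step[OF step.IH] by simp
  qed
  have "rot ` T \<in> farey_triangles \<longleftrightarrow> T \<in> farey_triangles" for T
    using *[of T] *[of "rot ` rot ` T"] *[of "rot ` T"] by (auto simp: image_image rot_rot_rot)
  moreover have "bij rot" by (rule o_bij[of "rot \<circ> rot"]) (simp_all add: fun_eq_iff rot_rot_rot)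
  ultimately show ?thesis by (simp add: farey_sym_def ccw_rot)
qed

lemma farey_triangle_orbit:
  assumes "T \<in> farey_triangles"
  shows "\<exists>g. farey_sym g \<and> T = g ` {Some 0, Some 1, None}"
  using assms
proof induction
  case base
  then show ?case using farey_sym_id by (metis image_id id_apply)
next
  case (step T a b)
  then obtain g where g: "farey_sym g" "T = g ` {Some 0, Some 1, None}" by blast
  have "farey_sym (reflect a b \<circ> g)"
    using farey_sym_comp[OF farey_sym_reflect[OF step.hyps(2-4)] g(1)] .
  moreover have "reflect a b ` T = (reflect a b \<circ> g) ` {Some 0, Some 1, None}"
    unfolding g(2) by (simp add: image_comp)
  ultimately show ?case by blast
qed

lemma farey_vertex_orbit:
  assumes "T \<in> farey_triangles" "p \<in> T"
  shows "\<exists>g. farey_sym g \<and> g None = p"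
proof -
  obtain g where g: "farey_sym g" "T = g ` {Some 0, Some 1, None}"
    using farey_triangle_orbit[OF assms(1)] by blast
  have "rot None = Some 0" "(rot \<circ> rot) None = Some 1" by auto
  moreover have "farey_sym (g \<circ> rot)" "farey_sym (g \<circ> (rot \<circ> rot))"
    by (intro farey_sym_comp farey_sym_rot g(1))+
  moreover have "p = g None \<or> p = g (Some 0) \<or> p = g (Some 1)" using assms(2) g(2) by auto
  ultimately show ?thesis using g(1) by (metis comp_apply)
qed

lemma card_farey_triangle:
  assumes "T \<in> farey_triangles"
  shows "card T = 3"
proof -
  obtain g where g: "farey_sym g" "T = g ` {Some 0, Some 1, None}"
    using farey_triangle_orbit[OF assms] by blast
  then have "inj g" by (simp add: farey_sym_def bij_def)
  then show ?thesis unfolding g(2) card_image[OF inj_on_subset[OF \<open>inj g\<close> subset_UNIV]] by simp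
qed

section \<open>Farey neighbours\<close>

text \<open>The determinant condition \<open>\<bar>p s - q r\<bar> = 1\<close> is invariant under the generating reflections, which
  act by integer matrices of determinant \<open>- 1\<close>. It bounds the set of triangles from above.\<close>

definition farey_nbr :: "rhat \<Rightarrow> rhat \<Rightarrow> bool" where
  "farey_nbr a b \<longleftrightarrow> (\<exists>p q r s :: int. a = proj_pt (of_int p) (of_int q) \<and> b = proj_pt (of_int r) (of_int s) \<and>
     \<bar>p * s - q * r\<bar> = 1)"

lemma farey_nbrI:
  "\<bar>p * s - q * r\<bar> = 1 \<Longrightarrow> farey_nbr (proj_pt (of_int p) (of_int q)) (proj_pt (of_int r) (of_int s))"
  unfolding farey_nbr_def by blast

lemma farey_nbr_commute: "farey_nbr a b \<Longrightarrow> farey_nbr b a"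
proof -
  assume "farey_nbr a b"
  then obtain p q r s where *: "a = proj_pt (of_int p) (of_int q)" "b = proj_pt (of_int r) (of_int s)"
    "\<bar>p * s - q * r\<bar> = 1"
    unfolding farey_nbr_def by blast
  then have "\<bar>r * q - s * p\<bar> = 1" by (simp add: abs_minus_commute mult.commute)
  then show ?thesis unfolding * by (rule farey_nbrI)
qed

lemma farey_nbr_reflect:
  assumes "a \<in> {Some 0, Some 1, None}" "b \<in> {Some 0, Some 1, None}" "a \<noteq> b"
    and "farey_nbr u v"
  shows "farey_nbr (reflect a b u) (reflect a b v)"
proof -
  obtain p q r s where u: "u = proj_pt (of_int p) (of_int q)" and v: "v = proj_pt (of_int r) (of_int s)"
    and det: "\<bar>p * s - q * r\<bar> = 1"
    using assms(4) unfolding farey_nbr_def by blast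
  have nz: "of_int p \<noteq> (0::real) \<or> of_int q \<noteq> (0::real)" "of_int r \<noteq> (0::real) \<or> of_int s \<noteq> (0::real)"
    using det by auto
  show ?thesis unfolding u v
  proof (rule farey_generator_cases[OF assms(1-3)])
    show "farey_nbr (reflect (Some 0) None (proj_pt (of_int p) (of_int q)))
        (reflect (Some 0) None (proj_pt (of_int r) (of_int s)))"
      unfolding reflect_proj_pt using farey_nbrI[of "- p" s q "- r"] det by (simp add: algebra_simps)
    have "(2 * q - p) * s - q * (2 * s - r) = - (p * s - q * r)" by (simp add: algebra_simps)
    then show "farey_nbr (reflect (Some 1) None (proj_pt (of_int p) (of_int q)))
        (reflect (Some 1) None (proj_pt (of_int r) (of_int s)))"
      unfolding reflect_proj_pt using farey_nbrI[of "2 * q - p" s q "2 * s - r"] det by simp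
    have "p * (2 * r - s) - (2 * p - q) * r = - (p * s - q * r)" by (simp add: algebra_simps)
    then show "farey_nbr (reflect (Some 0) (Some 1) (proj_pt (of_int p) (of_int q)))
        (reflect (Some 0) (Some 1) (proj_pt (of_int r) (of_int s)))"
      unfolding reflect_proj_pt(3)[OF nz(1)] reflect_proj_pt(3)[OF nz(2)]
      using farey_nbrI[of p "2 * r - s" "2 * p - q" r] det by simp
  qed
qed

lemma farey_triangle_nbr:
  assumes "T \<in> farey_triangles" "u \<in> T" "v \<in> T" "u \<noteq> v"
  shows "farey_nbr u v"
  using assms
proof (induction arbitrary: u v)
  case base
  have "farey_nbr (Some 0) (Some 1)" "farey_nbr (Some 0) None" "farey_nbr (Some 1) None"
    using farey_nbrI[of 0 1 1 1] farey_nbrI[of 0 0 1 1] farey_nbrI[of 1 0 1 1]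
    by (simp_all add: proj_pt_def)
  then show ?case using base farey_nbr_commute by blast
next
  case (step T a b)
  then obtain u' v' where "u = reflect a b u'" "v = reflect a b v'" "u' \<in> T" "v' \<in> T" "u' \<noteq> v'" by auto
  then show ?case using step farey_nbr_reflect[OF step.hyps(2-4)] by simp
qed

lemma proj_pt_of_int_qhat: "proj_pt (of_int p) (of_int q) \<in> qhat"
  using Rats_divide[OF Rats_of_int Rats_of_int, of p q] by (simp add: proj_pt_def qhat_def)

lemma farey_nbr_qhat: "farey_nbr u v \<Longrightarrow> u \<in> qhat"
  unfolding farey_nbr_def using proj_pt_of_int_qhat by blast

lemma farey_triangle_qhat:
  assumes "T \<in> farey_triangles"
  shows "T \<subseteq> qhat"
proof
  fix u assume u: "u \<in> T"
  have "\<not> T \<subseteq> {u}"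
    using card_farey_triangle[OF assms] card_mono[of "{u}" T] by auto
  then obtain v where "v \<in> T" "u \<noteq> v" by auto
  then show "u \<in> qhat" using farey_nbr_qhat farey_triangle_nbr[OF assms u] by blast
qed

lemma farey_nbr_None:
  assumes "farey_nbr None u"
  shows "\<exists>j :: int. u = Some (of_int j)"
proof -
  obtain p q r s where "None = proj_pt (of_int p) (of_int q)" and u: "u = proj_pt (of_int r) (of_int s)"
    and det: "\<bar>p * s - q * r\<bar> = 1"
    using assms unfolding farey_nbr_def by blast
  then have "q = 0" by (auto simp: proj_pt_def split: if_splits)
  then have "\<bar>s\<bar> = 1" using det abs_zmult_eq_1[of s p] by (simp add: mult.commute)
  then have "s = 1 \<or> s = - 1" by auto
  then show ?thesis unfolding u proj_pt_def by (auto intro: exI[of _ r] exI[of _ "- r"])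
qed

lemma farey_nbr_of_int:
  assumes "farey_nbr (Some (of_int i)) (Some (of_int j))"
  shows "\<bar>i - j\<bar> = 1"
proof -
  obtain p q r s where i: "Some (of_int i) = proj_pt (of_int p) (of_int q)"
    and j: "Some (of_int j) = proj_pt (of_int r) (of_int s)" and det: "\<bar>p * s - q * r\<bar> = 1"
    using assms unfolding farey_nbr_def by blast
  have "of_int i * of_int q = (of_int p :: real)" "of_int j * of_int s = (of_int r :: real)"
    using i j by (auto simp: proj_pt_def split: if_splits)
  then have "p = i * q" "r = j * s" by (metis of_int_eq_iff of_int_mult)+
  then have "\<bar>(q * s) * (i - j)\<bar> = 1" using det by (simp add: algebra_simps)
  then show ?thesis using abs_zmult_eq_1[of "i - j" "q * s"] by (simp add: mult.commute)
qed

text \<open>The reflections in the sides at \<open>\<infinity>\<close> act on the index \<open>j\<close> of these triangles by \<open>- j - 1\<close> and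
  \<open>1 - j\<close>, and their composite is the translation by \<open>2\<close>.\<close>

lemma farey_triangle_integers: "{None, Some (of_int j), Some (of_int j + 1)} \<in> farey_triangles"
proof -
  define A where "A j \<longleftrightarrow> {None, Some (of_int j), Some (of_int j + 1)} \<in> farey_triangles" for j :: int
  have A0: "A 0" using farey_triangles.base by (simp add: A_def insert_commute)
  have r0: "A (- j - 1)" if "A j" for j
    using farey_triangles.step[OF that[unfolded A_def], of "Some 0" None]
    by (simp add: A_def insert_commute)
  have r1: "A (1 - j)" if "A j" for j
    using farey_triangles.step[OF that[unfolded A_def], of "Some 1" None]
    by (simp add: A_def insert_commute)
  have r2: "A (j + 2)" if "A j" for j using r1[OF r0[OF that]] by (simp add: add.commute)
  have "A (int n) \<and> A (int n + 1)" for n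
  proof (induction n)
    case 0
    then show ?case using A0 r1[OF A0] by simp
  next
    case (Suc n)
    then show ?case using r2[of "int n"] by (simp add: add_ac)
  qed
  moreover have "A (- int n - 1)" for n using r0 calculation by simp
  ultimately have "A j"
    by (metis add_diff_cancel_left' diff_minus_eq_add int_cases minus_add_distrib of_nat_Suc uminus_add_conv_diff)
  then show ?thesis by (simp add: A_def)
qed

lemma farey_triangles_at_None:
  "{None, x, y} \<in> farey_triangles \<longleftrightarrow> (\<exists>j :: int. {x, y} = {Some (of_int j), Some (of_int (j + 1))})"
proof
  assume T: "{None, x, y} \<in> farey_triangles"
  have ne: "x \<noteq> y" "None \<noteq> x" "None \<noteq> y"
    using card_farey_triangle[OF T] by (auto simp: card_insert_if split: if_splits)
  then have "farey_nbr None x" "farey_nbr None y" using farey_triangle_nbr[OF T] by auto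
  then obtain i j :: int where *: "x = Some (of_int i)" "y = Some (of_int j)"
    using farey_nbr_None by blast
  then have "\<bar>i - j\<bar> = 1" using farey_nbr_of_int farey_triangle_nbr[OF T, of x y] ne by auto
  then have "j = i + 1 \<or> i = j + 1" by auto
  then show "\<exists>j :: int. {x, y} = {Some (of_int j), Some (of_int (j + 1))}"
    using * by (auto simp: insert_commute)
next
  assume "\<exists>j :: int. {x, y} = {Some (of_int j), Some (of_int (j + 1))}"
  then obtain j :: int where "{x, y} = {Some (of_int j), Some (of_int j + 1)}" by auto
  then show "{None, x, y} \<in> farey_triangles" using farey_triangle_integers by metis
qed

section \<open>Fans\<close>

text \<open>A symmetry carries the fan at \<open>\<infinity>\<close> to the fan at \<open>p\<close>; if it reverses the orientation, the
  sequence of the integers is run through backwards.\<close>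

lemma farey_vertex_fan:
  assumes "T \<in> farey_triangles" "p \<in> T"
  shows "\<exists>X :: int \<Rightarrow> rhat. inj X \<and> (\<forall>j. ccw p (X j) (X (j + 1))) \<and>
    (\<forall>q r. {p, q, r} \<in> farey_triangles \<longleftrightarrow> (\<exists>j. {q, r} = {X j, X (j + 1)}))"
proof -
  obtain g where g: "farey_sym g" "g None = p" using farey_vertex_orbit[OF assms] by blast
  then have inj: "inj g" and surj: "surj g"
    and tri: "\<And>T. g ` T \<in> farey_triangles \<longleftrightarrow> T \<in> farey_triangles"
    by (auto simp: farey_sym_def bij_def)
  define Y :: "int \<Rightarrow> rhat" where "Y j = g (Some (of_int j))" for j
  have injY: "inj Y" by (auto simp: Y_def intro!: injI dest!: injD[OF inj])
  have Y: "{p, q, r} \<in> farey_triangles \<longleftrightarrow> (\<exists>j. {q, r} = {Y j, Y (j + 1)})" for q r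
  proof -
    obtain x y where q: "q = g x" and r: "r = g y" using surj by (metis surjD)
    have "{p, q, r} = g ` {None, x, y}" using g q r by simp
    then have "{p, q, r} \<in> farey_triangles \<longleftrightarrow>
        (\<exists>j :: int. {x, y} = {Some (of_int j), Some (of_int (j + 1))})"
      by (simp only: tri farey_triangles_at_None)
    also have "\<dots> \<longleftrightarrow> (\<exists>j :: int. g ` {x, y} = g ` {Some (of_int j), Some (of_int (j + 1))})"
      by (simp only: inj_image_eq_iff[OF inj])
    finally show ?thesis by (simp add: q r Y_def)
  qed
  have "(\<forall>a b c. ccw (g a) (g b) (g c) \<longleftrightarrow> ccw a b c) \<or> (\<forall>a b c. ccw (g a) (g b) (g c) \<longleftrightarrow> ccw c b a)"
    using g(1) by (simp add: farey_sym_def)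
  then show ?thesis
  proof
    assume ccw: "\<forall>a b c. ccw (g a) (g b) (g c) \<longleftrightarrow> ccw a b c"
    have "ccw p (Y j) (Y (j + 1))" for j
      unfolding g(2)[symmetric] Y_def ccw[rule_format] by simp
    then show ?thesis using injY Y by (intro exI[of _ Y]) blast
  next
    assume ccw: "\<forall>a b c. ccw (g a) (g b) (g c) \<longleftrightarrow> ccw c b a"
    have "ccw p (Y (- j)) (Y (- (j + 1)))" for j
      unfolding g(2)[symmetric] Y_def ccw[rule_format] by simp
    moreover have "inj (\<lambda>j. Y (- j))" using injY by (auto intro!: injI dest!: injD)
    moreover have "(\<exists>j. {q, r} = {Y j, Y (j + 1)}) \<longleftrightarrow> (\<exists>j. {q, r} = {Y (- j), Y (- (j + 1))})" for q r
    proof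
      assume "\<exists>j. {q, r} = {Y j, Y (j + 1)}"
      then obtain j where "{q, r} = {Y j, Y (j + 1)}" by blast
      then show "\<exists>j. {q, r} = {Y (- j), Y (- (j + 1))}"
        by (intro exI[of _ "- j - 1"]) (simp add: insert_commute add.commute)
    next
      assume "\<exists>j. {q, r} = {Y (- j), Y (- (j + 1))}"
      then obtain j where "{q, r} = {Y (- j), Y (- (j + 1))}" by blast
      have eq: "- (j + 1) = - j - 1" "- j - 1 + 1 = - j" by simp_all
      from \<open>{q, r} = {Y (- j), Y (- (j + 1))}\<close> show "\<exists>j. {q, r} = {Y j, Y (j + 1)}"
        by (intro exI[of _ "- j - 1"]) (simp only: eq insert_commute)
    qed
    ultimately show ?thesis using Y by (intro exI[of _ "\<lambda>j. Y (- j)"]) simp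
  qed
qed

lemma ccw_distinct: "ccw a b c \<Longrightarrow> a \<noteq> b \<and> b \<noteq> c \<and> c \<noteq> a"
proof -
  have "bracket x x = 0" for x by simp
  moreover assume "ccw a b c"
  ultimately show ?thesis by (auto simp only: ccw_iff_bracket mult_zero_left mult_zero_right)
qed

lemma farey_edge_iff:
  "{p, q} \<in> farey_edges \<longleftrightarrow> (\<exists>r. {p, q, r} \<in> farey_triangles)"
proof
  assume "{p, q} \<in> farey_edges"
  then obtain T where T: "T \<in> farey_triangles" "{p, q} \<subseteq> T" and pq: "card {p, q} = 2"
    by (auto simp: farey_edges_def)
  have "card (T - {p, q}) = 1"
    using card_farey_triangle[OF T(1)] T(2) pq by (subst card_Diff_subset) auto
  then obtain r where "T - {p, q} = {r}" by (auto simp: card_1_singleton_iff)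
  then have "T = {p, q, r}" using T(2) by auto
  then show "\<exists>r. {p, q, r} \<in> farey_triangles" using T(1) by auto
next
  assume "\<exists>r. {p, q, r} \<in> farey_triangles"
  then obtain r where r: "{p, q, r} \<in> farey_triangles" by blast
  then have "p \<noteq> q" using card_farey_triangle[OF r] by (auto simp: card_insert_if split: if_splits)
  then show "{p, q} \<in> farey_edges" using r by (auto simp: farey_edges_def)
qed

lemma farey_triangle_distinct:
  "{p, q, r} \<in> farey_triangles \<Longrightarrow> p \<noteq> q \<and> q \<noteq> r \<and> r \<noteq> p"
  by (drule card_farey_triangle) (auto simp: card_insert_if split: if_splits)

lemma fan_listing_exists:
  assumes "T \<in> farey_triangles" "p \<in> T"
  shows "\<exists>X :: int \<Rightarrow> rhat. fan_listing p (\<lambda>j. {p, X j}) \<and>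
    (\<forall>q r. {p, q, r} \<in> farey_triangles \<longleftrightarrow> (\<exists>j. {q, r} = {X j, X (j + 1)}))"
proof -
  obtain X :: "int \<Rightarrow> rhat" where inj: "inj X" and ccw: "\<And>j. ccw p (X j) (X (j + 1))"
    and tri: "\<And>q r. {p, q, r} \<in> farey_triangles \<longleftrightarrow> (\<exists>j. {q, r} = {X j, X (j + 1)})"
    using farey_vertex_fan[OF assms] by metis
  have T: "{p, X j, X (j + 1)} \<in> farey_triangles" for j using tri by blast
  have "inj (\<lambda>j. {p, X j})"
    using ccw[THEN ccw_distinct] inj by (auto intro!: injI simp: doubleton_eq_iff dest: injD)
  moreover have "range (\<lambda>j. {p, X j}) = fan p"
  proof
    show "range (\<lambda>j. {p, X j}) \<subseteq> fan p"
    proof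
      fix E assume "E \<in> range (\<lambda>j. {p, X j})"
      then obtain j where "E = {p, X j}" by blast
      then show "E \<in> fan p" using T[of j] farey_edge_iff[of p "X j"] by (auto simp: fan_def)
    qed
    show "fan p \<subseteq> range (\<lambda>j. {p, X j})"
    proof
      fix E assume E: "E \<in> fan p"
      then have "card E = 2" "p \<in> E" by (auto simp: fan_def farey_edges_def)
      then obtain q where q: "E = {p, q}" by (auto simp: card_2_iff)
      then obtain r where "{p, q, r} \<in> farey_triangles" using E by (auto simp: fan_def farey_edge_iff)
      then obtain j where "{q, r} = {X j, X (j + 1)}" using tri by blast
      then have "q = X j \<or> q = X (j + 1)" by auto
      then show "E \<in> range (\<lambda>j. {p, X j})" using q by auto
    qed
  qed
  ultimately have bij: "bij_betw (\<lambda>j. {p, X j}) UNIV (fan p)" by (simp add: bij_betw_def)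
  have "fan_listing p (\<lambda>j. {p, X j})"
    unfolding fan_listing_def
  proof (intro conjI allI)
    fix j
    show "\<exists>T\<in>farey_triangles. {p, X j} \<subseteq> T \<and> {p, X (j + 1)} \<subseteq> T"
      using T[of j] by (intro bexI[of _ "{p, X j, X (j + 1)}"]) auto
    show "\<exists>x y. {p, X j} = {p, x} \<and> {p, X (j + 1)} = {p, y} \<and> ccw p x y"
      using ccw[of j] by (intro exI[of _ "X j"] exI[of _ "X (j + 1)"]) simp
  qed (rule bij)
  then show ?thesis using tri by blast
qed

text \<open>In the fan at \<open>p\<close> the edge with index \<open>j\<close> has only the neighbours with index \<open>j - 1\<close> and \<open>j + 1\<close>.
  This makes the shear function well defined.\<close>

lemma farey_edge_two_triangles:
  assumes "{p, q, x} \<in> farey_triangles" "{p, q, z} \<in> farey_triangles" "x \<noteq> z"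
    and "{p, q, c} \<in> farey_triangles"
  shows "c = x \<or> c = z"
proof -
  obtain X :: "int \<Rightarrow> rhat" where inj: "inj X"
    and tri: "\<And>q r. {p, q, r} \<in> farey_triangles \<longleftrightarrow> (\<exists>j. {q, r} = {X j, X (j + 1)})"
    using farey_vertex_fan[OF assms(1), of p] by auto
  obtain i where "{q, x} = {X i, X (i + 1)}" using tri[of q x] assms(1) by blast
  then have "q = X i \<or> q = X (i + 1)" by (auto simp: doubleton_eq_iff)
  then obtain j where j: "q = X j" by blast
  have *: "r = X (j - 1) \<or> r = X (j + 1)" if r: "{p, q, r} \<in> farey_triangles" for r
  proof -
    obtain i where "{q, r} = {X i, X (i + 1)}" using tri[of q r] r by blast
    then have "(X j = X i \<and> r = X (i + 1)) \<or> (X j = X (i + 1) \<and> r = X i)"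
      by (auto simp: doubleton_eq_iff j)
    then show ?thesis using injD[OF inj] by (metis add_diff_cancel_right')
  qed
  from *[OF assms(1)] *[OF assms(2)] *[OF assms(4)] show ?thesis using assms(3) by blast
qed

lemma fan_listing_tips:
  assumes "fan_listing p E"
  shows "\<exists>X :: int \<Rightarrow> rhat. \<forall>j. E j = {p, X j} \<and> ccw p (X j) (X (j + 1)) \<and>
    {p, X j, X (j + 1)} \<in> farey_triangles"
proof -
  have *: "\<exists>x y. E j = {p, x} \<and> E (j + 1) = {p, y} \<and> ccw p x y \<and> {p, x, y} \<in> farey_triangles" for j
  proof -
    obtain x y T where xy: "E j = {p, x}" "E (j + 1) = {p, y}" "ccw p x y"
      and T: "T \<in> farey_triangles" "E j \<subseteq> T" "E (j + 1) \<subseteq> T"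
      using assms unfolding fan_listing_def by metis
    have "card {p, x, y} = 3" using ccw_distinct[OF xy(3)] by auto
    then have "{p, x, y} = T"
      using T xy card_farey_triangle[OF T(1)] by (intro card_subset_eq) (auto intro: card_ge_0_finite)
    then show ?thesis using xy T(1) by blast
  qed
  define X where "X j = (SOME x. E j = {p, x})" for j
  have X: "E j = {p, X j}" for j
    unfolding X_def by (rule someI_ex) (use *[of j] in blast)
  have "ccw p (X j) (X (j + 1)) \<and> {p, X j, X (j + 1)} \<in> farey_triangles" for j
  proof -
    obtain x y where xy: "E j = {p, x}" "E (j + 1) = {p, y}" "ccw p x y" "{p, x, y} \<in> farey_triangles"
      using *[of j] by blast
    then have "X j = x" "X (j + 1) = y"
      using X[of j] X[of "j + 1"] ccw_distinct[OF xy(3)] by (auto simp: doubleton_eq_iff)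
    then show ?thesis using xy by simp
  qed
  then show ?thesis using X by blast
qed

section \<open>Corners and shears\<close>

text \<open>The logarithm of the length that the triangle \<open>h p, h q, h r\<close> cuts out of a horocycle at \<open>h p\<close>,
  for the horocycle with \<open>horo_weight\<close> equal to \<open>1\<close>.\<close>

definition corner :: "(rhat \<Rightarrow> rhat) \<Rightarrow> rhat \<Rightarrow> rhat \<Rightarrow> rhat \<Rightarrow> real" where
  "corner h p q r = ln \<bar>bracket (h q) (h r)\<bar> - ln \<bar>bracket (h p) (h q)\<bar> - ln \<bar>bracket (h p) (h r)\<bar>"

lemma corner_commute: "corner h p q r = corner h p r q"
  unfolding corner_def using abs_bracket_commute[of "h q" "h r"] by simp

lemma corner_cong: "{q, r} = {q', r'} \<Longrightarrow> corner h p q r = corner h p q' r'"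
  using corner_commute by (auto simp: doubleton_eq_iff)

lemma corner_add:
  "corner h p q r + corner h q p r = - 2 * ln \<bar>bracket (h p) (h q)\<bar>"
  unfolding corner_def using abs_bracket_commute[of "h q" "h p"] by simp

lemma orientation_preserving_homeo_inj:
  assumes "orientation_preserving_homeo h"
  shows "inj h"
proof -
  have "topspace rhat_top = UNIV"
    unfolding rhat_top_def by (auto simp: image_iff)
  then show ?thesis
    using assms homeomorphic_imp_injective_map[of rhat_top rhat_top h] unfolding orientation_preserving_homeo_def by fastforce
qed

text \<open>Both \<open>(a, b, c, d) = (y, p, x, z)\<close> and \<open>(p, y, z, x)\<close> meet the description of the shear along
  \<open>{p, y}\<close>, with the same value; the other two assignments give the image of the first triangle
  the wrong orientation.\<close>

lemma shear_function_fan: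
  assumes h: "orientation_preserving_homeo h"
    and T: "{p, x, y} \<in> farey_triangles" "{p, y, z} \<in> farey_triangles"
    and ccw: "ccw p x y" "ccw p y z"
  shows "shear_function h {p, y} = corner h p y z - corner h p x y"
proof -
  have inj: "inj h" by (rule orientation_preserving_homeo_inj[OF h])
  have hccw: "ccw (h a) (h b) (h c)" if "ccw a b c" for a b c
    using h that unfolding orientation_preserving_homeo_def by blast
  have antisym: "\<not> ccw a c b" if "ccw a b c" for a b c
    using that bracket_swap[of a b] bracket_swap[of b c] bracket_swap[of c a]
    by (auto simp: ccw_iff_bracket algebra_simps)
  have rotate: "ccw b c a" if "ccw a b c" for a b c
    using that by (simp add: ccw_iff_bracket mult_ac)
  have xz: "x \<noteq> z" using ccw antisym by blast
  have ne: "p \<noteq> x" "p \<noteq> y" "p \<noteq> z" "x \<noteq> y" "y \<noteq> z"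
    using ccw ccw_distinct by blast+
  have hne: "h a \<noteq> h b" if "a \<noteq> b" for a b using that inj by (simp add: inj_eq)
  have val1: "shear (h y) (h p) (h x) (h z) = corner h p y z - corner h p x y"
    unfolding corner_def using ne hne
    by (subst shear_eq) (simp_all add: ln_div ln_mult abs_bracket_commute)
  have val2: "shear (h p) (h y) (h z) (h x) = corner h p y z - corner h p x y"
    unfolding corner_def using ne hne
    by (subst shear_eq) (simp_all add: ln_div ln_mult abs_bracket_commute)
  let ?P = "\<lambda>s. \<exists>a b c d. {p, y} = {a, b} \<and> c \<noteq> d \<and> {a, b, c} \<in> farey_triangles \<and>
    {a, b, d} \<in> farey_triangles \<and> ccw (h a) (h b) (h c) \<and> s = shear (h a) (h b) (h c) (h d)"
  have T': "{p, y, x} \<in> farey_triangles" using T(1) by (simp add: insert_commute)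
  show ?thesis
    unfolding shear_function_def
  proof (rule the_equality)
    have "ccw (h y) (h p) (h x)" using hccw rotate ccw(1) by blast
    then show "?P (corner h p y z - corner h p x y)"
      using T T' xz val1 by (intro exI[of _ y] exI[of _ p] exI[of _ x] exI[of _ z]) (auto simp: insert_commute)
  next
    fix s assume "?P s"
    then obtain a b c d where ab: "{p, y} = {a, b}" and cd: "c \<noteq> d"
      and abc: "{a, b, c} \<in> farey_triangles" and abd: "{a, b, d} \<in> farey_triangles"
      and o: "ccw (h a) (h b) (h c)" and s: "s = shear (h a) (h b) (h c) (h d)"
      by blast
    have "{a, b, e} = {p, y, e}" for e using ab by auto
    then have c: "c = x \<or> c = z" and d: "d = x \<or> d = z"
      using farey_edge_two_triangles[OF T' T(2) xz] abc abd by auto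
    consider "a = y" "b = p" | "a = p" "b = y" using ab by (auto simp: doubleton_eq_iff)
    then show "s = corner h p y z - corner h p x y"
    proof cases
      case 1
      have "\<not> ccw (h y) (h p) (h z)" using antisym rotate hccw ccw(2) by blast
      then have "c = x" using o c 1 by auto
      then show ?thesis using cd d s val1 1 by auto
    next
      case 2
      have "\<not> ccw (h p) (h y) (h x)" using antisym hccw ccw(1) by blast
      then have "c = z" using o c 2 by auto
      then show ?thesis using cd d s val2 2 by auto
    qed
  qed
qed

lemma sum_int_telescope:
  fixes f :: "int \<Rightarrow> real"
  assumes "n \<le> m"
  shows "(\<Sum>j = n..m. f j - f (j - 1)) = f m - f (n - 1)"
  using assms
proof (induction m rule: int_ge_induct)
  case (step i)
  have "{n..i + 1} = insert (i + 1) {n..i}" using step.hyps by auto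
  then show ?case using step by simp
qed simp

lemma sum_shear_function_fan:
  fixes X :: "int \<Rightarrow> rhat"
  assumes "orientation_preserving_homeo h"
    and "\<And>j. ccw p (X j) (X (j + 1))" "\<And>j. {p, X j, X (j + 1)} \<in> farey_triangles" "n \<le> m"
  shows "(\<Sum>j = n..m. shear_function h {p, X j}) =
    corner h p (X m) (X (m + 1)) - corner h p (X (n - 1)) (X n)"
proof -
  have "shear_function h {p, X j} = corner h p (X j) (X (j + 1)) - corner h p (X (j - 1)) (X j)" for j
  proof (rule shear_function_fan[OF assms(1)])
    show "ccw p (X j) (X (j + 1))" "{p, X j, X (j + 1)} \<in> farey_triangles" by (rule assms(2,3))+
    have "j - 1 + 1 = j" by simp
    then show "ccw p (X (j - 1)) (X j)" "{p, X (j - 1), X j} \<in> farey_triangles"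
      using assms(2)[of "j - 1"] assms(3)[of "j - 1"] by (simp_all only:)
  qed
  then show ?thesis
    using sum_int_telescope[OF assms(4), of "\<lambda>j. corner h p (X j) (X (j + 1))"] by simp
qed

section \<open>Fan sums and decorations in terms of corners\<close>

text \<open>The length cut out of a horocycle at a vertex varies by a bounded factor among the triangles at
  this vertex, uniformly in the vertex.\<close>

definition bounded_corner_variation :: "(rhat \<Rightarrow> rhat) \<Rightarrow> bool" where
  "bounded_corner_variation h \<longleftrightarrow> (\<exists>M>0. \<forall>p q r q' r'.
     {p, q, r} \<in> farey_triangles \<longrightarrow> {p, q', r'} \<in> farey_triangles \<longrightarrow>
     \<bar>corner h p q r - corner h p q' r'\<bar> \<le> M)"

lemma bounded_fan_sums_iff:
  assumes h: "orientation_preserving_homeo h"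
  shows "(\<exists>M>0. \<forall>p\<in>qhat. \<forall>E. fan_listing p E \<longrightarrow>
       (\<forall>n m :: int. n < m \<longrightarrow> \<bar>\<Sum>j = n..m. shear_function h (E j)\<bar> \<le> M))
    \<longleftrightarrow> bounded_corner_variation h"
proof
  assume "bounded_corner_variation h"
  then obtain M where M: "M > 0" and bd: "\<And>p q r q' r'. {p, q, r} \<in> farey_triangles \<Longrightarrow>
      {p, q', r'} \<in> farey_triangles \<Longrightarrow> \<bar>corner h p q r - corner h p q' r'\<bar> \<le> M"
    unfolding bounded_corner_variation_def by blast
  have "\<bar>\<Sum>j = n..m. shear_function h (E j)\<bar> \<le> M" if E: "fan_listing p E" and nm: "n < m" for p E n m
  proof -
    obtain X where X: "\<And>j. E j = {p, X j}" "\<And>j. ccw p (X j) (X (j + 1))"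
      "\<And>j. {p, X j, X (j + 1)} \<in> farey_triangles"
      using fan_listing_tips[OF E] by metis
    have "{p, X (n - 1), X n} \<in> farey_triangles" using X(3)[of "n - 1"] by simp
    with bd[OF X(3)[of m] this] show ?thesis
      using nm unfolding X(1) by (subst sum_shear_function_fan[where X = X, OF h X(2,3)]) auto
  qed
  then show "\<exists>M>0. \<forall>p\<in>qhat. \<forall>E. fan_listing p E \<longrightarrow>
       (\<forall>n m :: int. n < m \<longrightarrow> \<bar>\<Sum>j = n..m. shear_function h (E j)\<bar> \<le> M)"
    using M by blast
next
  assume "\<exists>M>0. \<forall>p\<in>qhat. \<forall>E. fan_listing p E \<longrightarrow>
       (\<forall>n m :: int. n < m \<longrightarrow> \<bar>\<Sum>j = n..m. shear_function h (E j)\<bar> \<le> M)"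
  then obtain M where M: "M > 0" and bd: "\<And>p E n m. p \<in> qhat \<Longrightarrow> fan_listing p E \<Longrightarrow> n < m \<Longrightarrow>
      \<bar>\<Sum>j = n..(m::int). shear_function h (E j)\<bar> \<le> M"
    by blast
  have "\<bar>corner h p q r - corner h p q' r'\<bar> \<le> 2 * M"
    if T: "{p, q, r} \<in> farey_triangles" and T': "{p, q', r'} \<in> farey_triangles" for p q r q' r'
  proof -
    obtain X :: "int \<Rightarrow> rhat" where E: "fan_listing p (\<lambda>j. {p, X j})"
      and tri: "\<And>q r. {p, q, r} \<in> farey_triangles \<longleftrightarrow> (\<exists>j. {q, r} = {X j, X (j + 1)})"
      using fan_listing_exists[OF T, of p] by auto
    obtain Y where Y: "\<And>j. {p, X j} = {p, Y j}" "\<And>j. ccw p (Y j) (Y (j + 1))"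
      "\<And>j. {p, Y j, Y (j + 1)} \<in> farey_triangles"
      using fan_listing_tips[OF E] by metis
    have "Y = X" using Y(1,2) ccw_distinct by (fastforce simp: doubleton_eq_iff fun_eq_iff)
    note X = Y(2,3)[unfolded this]
    define f where "f j = corner h p (X j) (X (j + 1))" for j
    have p: "p \<in> qhat" using farey_triangle_qhat[OF T] by blast
    have f: "\<bar>f m - f n\<bar> \<le> M" if "n + 1 < m" for n m
      using bd[OF p E that] that sum_shear_function_fan[where X = X and n = "n + 1" and m = m, OF h X] by (simp add: f_def)
    obtain i j where i: "{q, r} = {X i, X (i + 1)}" and j: "{q', r'} = {X j, X (j + 1)}"
      using tri T T' by metis
    \<comment> \<open>the hypothesis concerns sums of at least two terms, which compare corners whose indices
        differ by two or more; so both corners are compared with one beyond them\<close>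
    define m where "m = max i j + 2"
    have "\<bar>f m - f i\<bar> \<le> M" "\<bar>f m - f j\<bar> \<le> M" using f by (auto simp: m_def)
    then show ?thesis
      unfolding corner_cong[OF i] corner_cong[OF j] f_def by linarith
  qed
  then show "bounded_corner_variation h"
    unfolding bounded_corner_variation_def using M by (intro exI[of _ "2 * M"]) auto
qed

text \<open>With \<open>w p = ln (horo_weight (h p) (k (h p)))\<close>, the logarithm of a lambda length is
  \<open>ln \<bar>bracket (h p) (h q)\<bar> + (w p + w q) / 2\<close>. A decoration is pinched iff \<open>w p\<close> is within a bounded
  distance of all corners at \<open>p\<close>: a corner minus \<open>w p\<close> is a signed sum of three logarithms of
  lambda lengths, and by \<open>corner_add\<close> the two corners of a triangle at the ends of a side add up to
  \<open>- 2 * ln \<bar>bracket (h p) (h q)\<bar>\<close>.\<close>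

lemma pinched_decoration_iff:
  assumes inj: "inj h"
  shows "(\<exists>k. decoration h k \<and> pinched_lambda_lengths h k) \<longleftrightarrow> bounded_corner_variation h"
proof
  assume "\<exists>k. decoration h k \<and> pinched_lambda_lengths h k"
  then obtain k M where k: "\<And>p. p \<in> qhat \<Longrightarrow> k (h p) > 0" and M: "M > 1"
    and bd: "\<And>a b. {a, b} \<in> farey_edges \<Longrightarrow>
      1 / M \<le> lambda_length k (h a) (h b) \<and> lambda_length k (h a) (h b) \<le> M"
    unfolding decoration_def pinched_lambda_lengths_def by blast
  define w where "w p = ln (horo_weight (h p) (k (h p)))" for p
  have edge: "\<bar>ln \<bar>bracket (h p) (h q)\<bar> + (w p + w q) / 2\<bar> \<le> ln M"
    if T: "{p, q, r} \<in> farey_triangles" for p q r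
  proof -
    have pq: "h p \<noteq> h q" using farey_triangle_distinct[OF T] inj by (simp add: inj_eq)
    have kpos: "k (h p) > 0" "k (h q) > 0" using farey_triangle_qhat[OF T] k by auto
    let ?l = "lambda_length k (h p) (h q)"
    have l: "1 / M \<le> ?l" "?l \<le> M" using bd T farey_edge_iff by blast+
    then have "?l > 0" using M by (meson less_le_trans zero_less_divide_1_iff less_trans zero_less_one)
    then have "ln ?l \<le> ln M" "ln (1 / M) \<le> ln ?l" using l M by simp_all
    then have "\<bar>ln ?l\<bar> \<le> ln M" using M by (simp add: ln_div abs_le_iff)
    then show ?thesis unfolding ln_lambda_length[of "h p" "h q" k, OF pq kpos] w_def .
  qed
  have "\<bar>corner h p q r - w p\<bar> \<le> 3 * ln M" if T: "{p, q, r} \<in> farey_triangles" for p q r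
  proof -
    have T': "{q, r, p} \<in> farey_triangles" "{p, r, q} \<in> farey_triangles"
      using T by (simp_all add: insert_commute)
    show ?thesis
      using edge[OF T] edge[OF T'(1)] edge[OF T'(2)] unfolding corner_def by argo
  qed
  then have "\<bar>corner h p q r - corner h p q' r'\<bar> \<le> 6 * ln M"
    if "{p, q, r} \<in> farey_triangles" "{p, q', r'} \<in> farey_triangles" for p q r q' r'
    using that by (smt (verit))
  then show "bounded_corner_variation h"
    unfolding bounded_corner_variation_def using M by (intro exI[of _ "6 * ln M"]) auto
next
  assume "bounded_corner_variation h"
  then obtain M where M: "M > 0" and bd: "\<And>p q r q' r'. {p, q, r} \<in> farey_triangles \<Longrightarrow>
      {p, q', r'} \<in> farey_triangles \<Longrightarrow> \<bar>corner h p q r - corner h p q' r'\<bar> \<le> M"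
    unfolding bounded_corner_variation_def by blast
  have "\<exists>w. \<forall>q r. {p, q, r} \<in> farey_triangles \<longrightarrow> \<bar>corner h p q r - w\<bar> \<le> M" for p
  proof (cases "\<exists>q r. {p, q, r} \<in> farey_triangles")
    case True
    then show ?thesis using bd by blast
  qed auto
  then obtain w where w: "\<And>p q r. {p, q, r} \<in> farey_triangles \<Longrightarrow> \<bar>corner h p q r - w p\<bar> \<le> M"
    by metis
  define k where "k a = (case a of None \<Rightarrow> exp (w (inv h a)) | Some x \<Rightarrow> 1 / (2 * exp (w (inv h a))))" for a
  have kpos: "k a > 0" for a by (cases a) (auto simp: k_def)
  have weight: "ln (horo_weight (h p) (k (h p))) = w p" for p
    using inv_f_f[OF inj, of p] by (cases "h p") (auto simp: k_def)
  have "exp (- M) \<le> lambda_length k (h p) (h q) \<and> lambda_length k (h p) (h q) \<le> exp M"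
    if "{p, q} \<in> farey_edges" for p q
  proof -
    obtain r where T: "{p, q, r} \<in> farey_triangles" using \<open>{p, q} \<in> farey_edges\<close> farey_edge_iff by blast
    then have T': "{q, p, r} \<in> farey_triangles" by (simp add: insert_commute)
    have "h p \<noteq> h q" using farey_triangle_distinct[OF T] inj by (simp add: inj_eq)
    then have "ln (lambda_length k (h p) (h q)) = ln \<bar>bracket (h p) (h q)\<bar> + (w p + w q) / 2"
      by (simp add: ln_lambda_length kpos weight)
    also have "\<bar>\<dots>\<bar> \<le> M"
      using corner_add[of h p q r] w[OF T] w[OF T'] by argo
    finally have "\<bar>ln (lambda_length k (h p) (h q))\<bar> \<le> M" .
    moreover have "lambda_length k (h p) (h q) > 0" by (simp add: lambda_length_def)
    ultimately show ?thesis by (metis abs_le_iff exp_le_cancel_iff exp_ln minus_le_iff)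
  qed
  then have "pinched_lambda_lengths h k"
    unfolding pinched_lambda_lengths_def using M
    by (intro exI[of _ "exp M"]) (auto simp: exp_minus inverse_eq_divide)
  moreover have "decoration h k" using kpos by (simp add: decoration_def)
  ultimately show "\<exists>k. decoration h k \<and> pinched_lambda_lengths h k" by blast
qed

theorem theorem1p1:
  fixes h :: "rhat \<Rightarrow> rhat"
  assumes "quasisymmetric h"
  shows "(\<exists>k. decoration h k \<and> pinched_lambda_lengths h k) \<longleftrightarrow>
    (\<exists>M>0. \<forall>p\<in>qhat. \<forall>E. fan_listing p E \<longrightarrow>
       (\<forall>n m :: int. n < m \<longrightarrow> \<bar>\<Sum>j = n..m. shear_function h (E j)\<bar> \<le> M))"
proof -
  have h: "orientation_preserving_homeo h" using assms by (simp add: quasisymmetric_def)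
  show ?thesis
    unfolding bounded_fan_sums_iff[OF h]
    by (rule pinched_decoration_iff[OF orientation_preserving_homeo_inj[OF h]])
qed

end
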